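(* Let $G$ be a signed graph admitting a nowhere-zero $\mathbb{Z}_3$-flow. Then $G$ admits a nowhere-zero $5$-flow $g$ such that $E_{g=\pm 3}=\emptyset$ and $E_{g=\pm 4}\subseteq B(G)$.
   Context: Graphs are finite and may have multiple edges and loops. A signed graph is a graph $G$ together with a signature $\sigma:E(G)\to\{-1,1\}$; an edge $e$ is positive if $\sigma(e)=1$ and negative if $\sigma(e)=-1$. Every edge $e$ consists of two half-edges $h,\hat h$, each incident with one end of $e$ (for a loop, both half-edges are incident with the same vertex). $H(G)$ is the set of half-edges, $H_G(v)$ the set of half-edges incident with the vertex $v$, and $e_h$ the edge containing $h$. An orientation of $(G,\sigma)$ is a map $\tau:H(G)\to\{-1,1\}$ with $\tau(h)\tau(\hat h)=-\sigma(e_h)$ for each $h\in H(G)$. Given an orientation $\tau$ and an abelian group $A$, the boundary of $f:E(G)\to A$ at $v$ is $\partial f(v)=\sum_{h\in H_G(v)}\tau(h)f(e_h)$. The map $f$ is an $A$-flow if $\partial f(v)=0$ for every vertex $v$. For a positive integer $k$, a $k$-flow is a $\mathbb{Z}$-flow with $|f(e)|<k$ for every edge $e$. A flow is nowhere-zero if $f(e)\neq 0$ for every $e\in E(G)$. The existence of such nowhere-zero flows does not depend on the chosen orientation. For an integer flow $g$ and a positive integer $t$, $E_{g=\pm t}=\{e\in E(G): |g(e)|=t\}$. $B(G)$ denotes the set of cut-edges (bridges) of $G$. *)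

theory Defs
  imports Main "HOL-Library.Numeral_Type"
begin

text \<open>
  Finite multigraphs with loops. Every edge \<open>e\<close> has exactly two half-edges, \<open>(e, False)\<close> and
  \<open>(e, True)\<close>; \<open>ends G h\<close> is the vertex incident with the half-edge \<open>h\<close>. The Boolean merely tells
  the two half-edges apart; it does not direct the edge.
\<close>

record ('v, 'e) sgraph =
  verts :: "'v set"
  edges :: "'e set"
  ends :: "'e \<times> bool \<Rightarrow> 'v"
  signature :: "'e \<Rightarrow> int"

definition half_edges :: "('v, 'e) sgraph \<Rightarrow> ('e \<times> bool) set" where
  "half_edges G = edges G \<times> UNIV"

definition half_edges_at :: "('v, 'e) sgraph \<Rightarrow> 'v \<Rightarrow> ('e \<times> bool) set" where
  "half_edges_at G v = {h \<in> half_edges G. ends G h = v}"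

abbreviation edge_of :: "'e \<times> bool \<Rightarrow> 'e" where
  "edge_of h \<equiv> fst h"

definition opp :: "'e \<times> bool \<Rightarrow> 'e \<times> bool" where
  "opp h = (fst h, \<not> snd h)"

definition signed_graph :: "('v, 'e) sgraph \<Rightarrow> bool" where
  "signed_graph G \<longleftrightarrow> finite (verts G) \<and> finite (edges G)
    \<and> (\<forall>h \<in> half_edges G. ends G h \<in> verts G)
    \<and> (\<forall>e \<in> edges G. signature G e \<in> {-1, 1})"

definition orientation :: "('v, 'e) sgraph \<Rightarrow> ('e \<times> bool \<Rightarrow> int) \<Rightarrow> bool" where
  "orientation G \<tau> \<longleftrightarrow>
    (\<forall>h \<in> half_edges G. \<tau> h \<in> {-1, 1} \<and> \<tau> h * \<tau> (opp h) = - signature G (edge_of h))"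

text \<open>The action of the signs \<open>1\<close> and \<open>-1\<close> on an abelian group; other integers do not occur.\<close>

definition sign_times :: "int \<Rightarrow> 'a::ab_group_add \<Rightarrow> 'a" where
  "sign_times s a = (if s = 1 then a else - a)"

definition boundary ::
  "('v, 'e) sgraph \<Rightarrow> ('e \<times> bool \<Rightarrow> int) \<Rightarrow> ('e \<Rightarrow> 'a::ab_group_add) \<Rightarrow> 'v \<Rightarrow> 'a" where
  "boundary G \<tau> f v = (\<Sum>h \<in> half_edges_at G v. sign_times (\<tau> h) (f (edge_of h)))"

definition flow ::
  "('v, 'e) sgraph \<Rightarrow> ('e \<times> bool \<Rightarrow> int) \<Rightarrow> ('e \<Rightarrow> 'a::ab_group_add) \<Rightarrow> bool" where
  "flow G \<tau> f \<longleftrightarrow> (\<forall>v \<in> verts G. boundary G \<tau> f v = 0)"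

definition nowhere_zero :: "('v, 'e) sgraph \<Rightarrow> ('e \<Rightarrow> 'a::zero) \<Rightarrow> bool" where
  "nowhere_zero G f \<longleftrightarrow> (\<forall>e \<in> edges G. f e \<noteq> 0)"

definition k_flow ::
  "nat \<Rightarrow> ('v, 'e) sgraph \<Rightarrow> ('e \<times> bool \<Rightarrow> int) \<Rightarrow> ('e \<Rightarrow> int) \<Rightarrow> bool" where
  "k_flow k G \<tau> f \<longleftrightarrow> flow G \<tau> f \<and> (\<forall>e \<in> edges G. \<bar>f e\<bar> < int k)"

definition edges_with_abs :: "('v, 'e) sgraph \<Rightarrow> ('e \<Rightarrow> int) \<Rightarrow> nat \<Rightarrow> 'e set" where
  "edges_with_abs G g t = {e \<in> edges G. \<bar>g e\<bar> = int t}"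

definition adjacency :: "('v, 'e) sgraph \<Rightarrow> 'v rel" where
  "adjacency G = {(ends G h, ends G (opp h)) | h. h \<in> half_edges G}"

definition components :: "('v, 'e) sgraph \<Rightarrow> 'v set set" where
  "components G = verts G // (adjacency G)\<^sup>*"

definition delete_edge :: "('v, 'e) sgraph \<Rightarrow> 'e \<Rightarrow> ('v, 'e) sgraph" where
  "delete_edge G e = G\<lparr>edges := edges G - {e}\<rparr>"

definition bridges :: "('v, 'e) sgraph \<Rightarrow> 'e set" where
  "bridges G = {e \<in> edges G. card (components (delete_edge G e)) > card (components G)}"

end

theory Submission
  imports Defs Complex_Main "HOL-Library.Disjoint_Sets"
begin

text \<open>
  The nowhere-zero flow over \<open>\<int>\<^sub>3\<close> has the values \<open>1\<close> and \<open>-1\<close> only, so after reorienting some edges it is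
  constantly \<open>1\<close>. A lift to an integer flow with values in \<open>{1, -2}\<close> amounts to choosing the edges
  that receive \<open>-2\<close>. Seen from the half-edges, every half-edge \<open>h\<close> has a load, the residue \<open>1\<close> or \<open>2\<close>
  of \<open>\<tau> h\<close> modulo \<open>3\<close>, and one looks for a set \<open>Y\<close> of half-edges that contains, at each vertex, exactly
  a third of the total load there (its demand), both or none of the halves of a negative edge, and
  exactly one half of a positive edge. For a cubic graph with all edges negative and all half-edges
  pointing the same way this is a perfect matching, so the lift generalises Petersen's theorem that a
  bridgeless cubic graph has one.

  In general such a \<open>Y\<close> is a perfect matching of an auxiliary graph, the gadget. Giving each half-edge
  a third of its load solves the problem fractionally, and yields a fractional perfect
  matching of the gadget. By the Tutte--Berge formula a graph with a fractional perfect matching has a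
  perfect matching as soon as every cut around an odd set of vertices has weight at least \<open>1\<close>
  (lemma \<open>edmonds_fractional_matching\<close>). In the gadget, a cut that splits the copies of some vertex has
  weight at least \<open>1\<close>. Every other cut has a weight that is a multiple of \<open>1/3\<close>, and this multiple
  has the parity of the set it surrounds. So an odd cut of weight below \<open>1\<close> has
  weight exactly \<open>1/3\<close>, and then it comes from a cut of \<open>G\<close> that consists of a single edge
  (lemma \<open>odd_cut\<close>). Hence a graph without bridges has an integer flow with values \<open>1\<close> and \<open>-2\<close>
  (lemma \<open>mod3_flow_lift\<close>).

  Bridges are removed by doubling them. In \<open>\<int>\<^sub>3\<close> one has \<open>a = (-a) + (-a)\<close>, so a bridge with value \<open>a\<close> can
  be replaced by two parallel edges with value \<open>-a\<close> each. The new graph has no bridge. In the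
  integer lift the two copies have values of absolute value \<open>1\<close> or \<open>2\<close> that are congruent modulo \<open>3\<close>, and
  the sum of two such values has absolute value \<open>1\<close>, \<open>2\<close> or \<open>4\<close>.
\<close>

section \<open>Perfect matchings from fractional perfect matchings\<close>

lemma card_2_other:
  assumes "card e = 2" "x \<in> e"
  obtains y where "e = {x, y}" "x \<noteq> y"
  using assms by (auto simp: card_2_iff)

definition matching :: "'a set set \<Rightarrow> 'a set set \<Rightarrow> bool" where
  "matching E M \<longleftrightarrow> M \<subseteq> E \<and> disjoint M"

lemma card_Union_matching:
  assumes "finite (\<Union>E)" "\<forall>e\<in>E. card e = 2" "matching E M"
  shows "card (\<Union>M) = 2 * card M"
proof -
  have fin: "finite e" if "e \<in> M" for e
    using assms that by (metis card.infinite matching_def subsetD zero_neq_numeral)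
  have "card (\<Union>M) = sum card M"
    using assms(3) fin by (intro card_Union_disjoint) (auto simp: matching_def)
  also have "\<dots> = sum (\<lambda>_. 2) M"
    using assms by (intro sum.cong) (auto simp: matching_def)
  finally show ?thesis by simp
qed

lemma finite_matching:
  assumes "finite (\<Union>E)" "matching E M"
  shows "finite M" "finite (\<Union>M)"
proof -
  have "finite E" using assms(1) by (rule finite_UnionD)
  thus "finite M" using assms(2) by (auto simp: matching_def intro: finite_subset)
  have "\<Union>M \<subseteq> \<Union>E" using assms(2) by (auto simp: matching_def)
  thus "finite (\<Union>M)" using assms(1) finite_subset by blast
qed

definition max_matching :: "'a set set \<Rightarrow> 'a set set \<Rightarrow> bool" where
  "max_matching E M \<longleftrightarrow> matching E M \<and> (\<forall>N. matching E N \<longrightarrow> card N \<le> card M)"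

lemma max_matching_exists:
  assumes "finite (\<Union>E)"
  shows "\<exists>M. max_matching E M"
proof -
  have "finite E" using assms finite_UnionD by blast
  hence "\<forall>N. matching E N \<longrightarrow> card N < Suc (card E)"
    by (auto simp: matching_def less_Suc_eq_le card_mono)
  moreover have "matching E {}" by (simp add: matching_def)
  ultimately show ?thesis
    using ex_has_greatest_nat[of "matching E" "{}" card "Suc (card E)"]
    unfolding max_matching_def by blast
qed

text \<open>
  Call two vertices related if no maximum matching misses both. This lemma says that the relation is
  transitive through every vertex \<open>t\<close> that some maximum matching misses. Given a maximum matching \<open>M\<close>
  that misses \<open>u\<close> and \<open>v\<close>, take a maximum matching \<open>N\<close> that misses \<open>t\<close> and shares as many edges
  with \<open>M\<close> as possible. As \<open>M\<close> and \<open>N\<close> cover equally many vertices and \<open>N\<close> covers \<open>u\<close> and \<open>v\<close>, there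
  is a vertex \<open>x\<close> other than \<open>t\<close> covered by \<open>M\<close> only; exchanging one edge of \<open>N\<close> for the edge of \<open>M\<close>
  at \<open>x\<close> contradicts the choice of \<open>N\<close>.
\<close>
lemma gallai_exchange:
  assumes fin: "finite (\<Union>E)" and two: "\<forall>e\<in>E. card e = 2"
    and t: "\<exists>N. max_matching E N \<and> t \<notin> \<Union>N"
    and ut: "\<And>N. max_matching E N \<Longrightarrow> u \<in> \<Union>N \<or> t \<in> \<Union>N"
    and vt: "\<And>N. max_matching E N \<Longrightarrow> v \<in> \<Union>N \<or> t \<in> \<Union>N"
    and M: "max_matching E M" and "u \<noteq> v"
  shows "u \<in> \<Union>M \<or> v \<in> \<Union>M"
proof (rule ccontr)
  assume neg: "\<not> (u \<in> \<Union>M \<or> v \<in> \<Union>M)"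
  obtain N where N: "max_matching E N" "t \<notin> \<Union>N"
    and best: "\<And>N'. max_matching E N' \<Longrightarrow> t \<notin> \<Union>N' \<Longrightarrow> card (M \<inter> N') \<le> card (M \<inter> N)"
  proof -
    have "\<forall>N. card (M \<inter> N) < Suc (card M)"
      using M finite_matching(1)[OF fin] by (auto simp: max_matching_def less_Suc_eq_le card_mono)
    thus ?thesis
      using t ex_has_greatest_nat[of "\<lambda>N. max_matching E N \<and> t \<notin> \<Union>N" _ "\<lambda>N. card (M \<inter> N)"
          "Suc (card M)"] that by blast
  qed
  have mM: "matching E M" and mN: "matching E N" using M N by (auto simp: max_matching_def)
  have "card M = card N"
    using M N by (simp add: max_matching_def le_antisym)
  hence eq: "card (\<Union>M) = card (\<Union>N)"
    using card_Union_matching[OF fin two] mM mN by simp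
  have fM: "finite (\<Union>M)" "finite (\<Union>N)" "finite N" "finite M" using finite_matching[OF fin] mM mN by blast+
  have "{u, v} \<subseteq> \<Union>N - \<Union>M" using ut[OF N(1)] vt[OF N(1)] N(2) neg by blast
  hence "2 \<le> card (\<Union>N - \<Union>M)" using card_mono[of "\<Union>N - \<Union>M" "{u,v}"] fM \<open>u \<noteq> v\<close> by simp
  moreover have "card (\<Union>N - \<Union>M) = card (\<Union>M - \<Union>N)"
    using eq fM card_Diff_subset_Int[of "\<Union>N" "\<Union>M"] card_Diff_subset_Int[of "\<Union>M" "\<Union>N"]
    by (simp add: Int_commute)
  ultimately have "\<not> \<Union>M - \<Union>N \<subseteq> {t}" using card_mono[of "{t}" "\<Union>M - \<Union>N"] by auto
  then obtain x where x: "x \<in> \<Union>M" "x \<notin> \<Union>N" "x \<noteq> t" by blast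
  then obtain e where e: "e \<in> M" "x \<in> e" by blast
  have "card e = 2" using e mM two by (auto simp: matching_def)
  then obtain y where y: "e = {x, y}" "x \<noteq> y" using e(2) by (rule card_2_other)
  have eE: "e \<in> E" using e mM by (auto simp: matching_def)
  have "e \<notin> N" using e x by blast
  have yN: "y \<in> \<Union>N"
  proof (rule ccontr)
    assume "y \<notin> \<Union>N"
    hence "matching E (insert e N)" using mN eE x y
      unfolding matching_def by (auto simp: pairwise_insert disjnt_def)
    hence "card (insert e N) \<le> card N" using N by (auto simp: max_matching_def)
    thus False using \<open>e \<notin> N\<close> fM by simp
  qed
  then obtain f where f: "f \<in> N" "y \<in> f" by blast
  define N' where "N' = insert e (N - {f})"
  have yf: "y \<notin> \<Union>(N - {f})"
    using f mN by (auto simp: matching_def pairwise_def disjnt_def)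
  have "matching E N'" using mN eE x y yf
    unfolding matching_def N'_def by (auto simp: pairwise_insert disjnt_def pairwise_def)
  moreover have "card N' = card N" using f \<open>e \<notin> N\<close> fM card_gt_0_iff[of N] by (auto simp: N'_def)
  ultimately have "max_matching E N'" using N by (simp add: max_matching_def)
  moreover have "t \<notin> \<Union>N'" using N(2) x(3) y yN by (auto simp: N'_def)
  ultimately have "card (M \<inter> N') \<le> card (M \<inter> N)" by (rule best)
  moreover have "f \<notin> M"
  proof
    assume "f \<in> M"
    moreover have "f \<noteq> e" using f(1) \<open>e \<notin> N\<close> by blast
    ultimately have "disjnt f e" using mM e(1) unfolding matching_def by (meson pairwiseD)
    thus False using f(2) y(1) by (auto simp: disjnt_def)
  qed
  hence "M \<inter> N' = insert e (M \<inter> N)" using e by (auto simp: N'_def)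
  ultimately show False using \<open>e \<notin> N\<close> fM by simp
qed

text \<open>
  \<open>\<K>\<close> plays the role of the set of odd components that remain after deleting \<open>U\<close>; a member may also be
  a union of components of odd total size.
\<close>
definition odd_barrier :: "'a set \<Rightarrow> 'a set set \<Rightarrow> 'a set \<Rightarrow> 'a set set \<Rightarrow> bool" where
  "odd_barrier W E U \<K> \<longleftrightarrow> U \<subseteq> W \<and> disjoint \<K> \<and> \<Union>\<K> \<subseteq> W - U \<and> (\<forall>K\<in>\<K>. odd (card K))
     \<and> (\<forall>e\<in>E. \<forall>K\<in>\<K>. e \<inter> K \<noteq> {} \<longrightarrow> e \<subseteq> K \<union> U)"

text \<open>
  The hard half of the Tutte--Berge formula, by induction on the number of vertices. If the graph is
  disconnected, the two parts are treated separately. A vertex covered by all maximum matchings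
  is deleted and joins the barrier, because deleting it lowers the matching number. In the remaining
  case adjacent vertices are never missed together, since an edge between them could be added; by
  \<open>gallai_exchange\<close> and connectedness no two vertices are, so every maximum matching
  misses a single vertex and the whole vertex set is one odd component.
\<close>
lemma tutte_berge:
  assumes "finite W" "\<forall>e\<in>E. e \<subseteq> W \<and> card e = 2"
  shows "\<exists>M U \<K>. matching E M \<and> odd_barrier W E U \<K> \<and> card W + card U \<le> 2 * card M + card \<K>"
  using assms
proof (induction "card W" arbitrary: W E rule: less_induct)
  case less
  note W = less.prems(1) and E = less.prems(2)
  have fin: "finite (\<Union>E)" using W E by (meson Sup_le_iff finite_subset)
  have two: "\<forall>e\<in>E. card e = 2" using E by blast
  consider (empty) "W = {}"
    | (disc) "\<exists>X. X \<subseteq> W \<and> X \<noteq> {} \<and> X \<noteq> W \<and> (\<forall>e\<in>E. e \<inter> X \<noteq> {} \<longrightarrow> e \<subseteq> X)"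
    | (ess) "\<exists>v\<in>W. \<forall>N. max_matching E N \<longrightarrow> v \<in> \<Union>N"
    | (crit) "W \<noteq> {}" "\<not> (\<exists>X. X \<subseteq> W \<and> X \<noteq> {} \<and> X \<noteq> W \<and> (\<forall>e\<in>E. e \<inter> X \<noteq> {} \<longrightarrow> e \<subseteq> X))"
        "\<not> (\<exists>v\<in>W. \<forall>N. max_matching E N \<longrightarrow> v \<in> \<Union>N)"
    by argo
  then show ?case
  proof cases
    case empty
    hence "matching E {}" "odd_barrier W E {} {}" by (auto simp: matching_def odd_barrier_def)
    thus ?thesis using empty by fastforce
  next
    case disc
    then obtain X where disc: "X \<subseteq> W" "X \<noteq> {}" "X \<noteq> W" "\<forall>e\<in>E. e \<inter> X \<noteq> {} \<longrightarrow> e \<subseteq> X"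
      by (elim exE conjE)
    define Y where "Y = W - X"
    define E1 E2 where "E1 = {e \<in> E. e \<subseteq> X}" and "E2 = {e \<in> E. e \<subseteq> Y}"
    have split: "E1 \<union> E2 = E" using disc(4) E unfolding E1_def E2_def Y_def by fast
    have "card X < card W" "card Y < card W"
      using disc W by (auto simp: Y_def intro!: psubset_card_mono)
    moreover have "finite X" "finite Y" using W disc by (auto simp: Y_def intro: finite_subset)
    moreover have "\<forall>e\<in>E1. e \<subseteq> X \<and> card e = 2" "\<forall>e\<in>E2. e \<subseteq> Y \<and> card e = 2"
      using E by (auto simp: E1_def E2_def)
    ultimately obtain M1 U1 K1 M2 U2 K2 where
      1: "matching E1 M1" "odd_barrier X E1 U1 K1" "card X + card U1 \<le> 2 * card M1 + card K1" and
      2: "matching E2 M2" "odd_barrier Y E2 U2 K2" "card Y + card U2 \<le> 2 * card M2 + card K2"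
      using less.hyps[of X E1] less.hyps[of Y E2] by blast
    have dXY: "X \<inter> Y = {}" by (auto simp: Y_def)
    have XY: "X \<union> Y = W" using disc by (auto simp: Y_def)
    have M1X: "\<Union>M1 \<subseteq> X" and M2Y: "\<Union>M2 \<subseteq> Y" using 1 2 by (auto simp: matching_def E1_def E2_def)
    have K1X: "\<Union>K1 \<subseteq> X - U1" and K2Y: "\<Union>K2 \<subseteq> Y - U2" and U12: "U1 \<subseteq> X" "U2 \<subseteq> Y"
      using 1 2 by (auto simp: odd_barrier_def)
    have ne: "{} \<notin> M1" "{} \<notin> K1"
    proof -
      have "\<forall>e\<in>M1. card e = 2" using 1(1) two by (auto simp: matching_def E1_def)
      thus "{} \<notin> M1" by fastforce
      have "\<forall>K\<in>K1. odd (card K)" using 1(2) by (simp add: odd_barrier_def)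
      thus "{} \<notin> K1" by fastforce
    qed
    have no_common: "\<C> \<inter> \<D> = {}" if "\<Union>\<C> \<inter> \<Union>\<D> = {}" "{} \<notin> \<C>" for \<C> \<D> :: "'a set set"
    proof (rule equals0I)
      fix m assume "m \<in> \<C> \<inter> \<D>"
      hence "m \<subseteq> \<Union>\<C> \<inter> \<Union>\<D>" "m \<in> \<C>" by (auto 0 3)
      thus False using that by (metis subset_empty)
    qed
    have dis: "disjoint M1" "disjoint M2" "disjoint K1" "disjoint K2"
      using 1 2 by (simp_all add: matching_def odd_barrier_def)
    have UM: "\<Union>M1 \<inter> \<Union>M2 = {}" using M1X M2Y dXY by blast
    have UK: "\<Union>K1 \<inter> \<Union>K2 = {}" using K1X K2Y dXY by blast
    have "matching E (M1 \<union> M2)"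
      unfolding matching_def
    proof
      show "M1 \<union> M2 \<subseteq> E" using 1 2 by (auto simp: matching_def E1_def E2_def)
      show "disjoint (M1 \<union> M2)" using dis UM by (intro disjoint_union)
    qed
    moreover have "odd_barrier W E (U1 \<union> U2) (K1 \<union> K2)"
      unfolding odd_barrier_def
    proof (intro conjI)
      show "disjoint (K1 \<union> K2)" using dis UK by (intro disjoint_union)
      show "\<forall>e\<in>E. \<forall>K\<in>K1 \<union> K2. e \<inter> K \<noteq> {} \<longrightarrow> e \<subseteq> K \<union> (U1 \<union> U2)"
      proof (intro ballI impI)
        fix e K assume e: "e \<in> E" "K \<in> K1 \<union> K2" "e \<inter> K \<noteq> {}"
        show "e \<subseteq> K \<union> (U1 \<union> U2)"
        proof (cases "K \<in> K1")
          case True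
          hence "K \<subseteq> X" using K1X by blast
          hence "\<not> e \<subseteq> Y" using e(3) dXY by blast
          hence "e \<in> E1" using split e(1) by (auto simp: E2_def)
          hence "e \<subseteq> K \<union> U1" using 1(2) True e(3) by (simp add: odd_barrier_def)
          thus ?thesis by blast
        next
          case False
          hence K: "K \<in> K2" using e(2) by blast
          hence "K \<subseteq> Y" using K2Y by blast
          hence "\<not> e \<subseteq> X" using e(3) dXY by blast
          hence "e \<in> E2" using split e(1) by (auto simp: E1_def)
          hence "e \<subseteq> K \<union> U2" using 2(2) K e(3) by (simp add: odd_barrier_def)
          thus ?thesis by blast
        qed
      qed
    next
      show "U1 \<union> U2 \<subseteq> W" using U12 XY by blast
      show "\<Union> (K1 \<union> K2) \<subseteq> W - (U1 \<union> U2)" using K1X K2Y U12 XY dXY by blast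
      show "\<forall>K\<in>K1 \<union> K2. odd (card K)" using 1(2) 2(2) unfolding odd_barrier_def by (meson UnE)
    qed
    moreover have "card (M1 \<union> M2) = card M1 + card M2"
    proof (rule card_Un_disjoint)
      show "M1 \<inter> M2 = {}" using no_common[OF UM ne(1)] .
      show "finite M1" "finite M2" using M1X M2Y \<open>finite X\<close> \<open>finite Y\<close>
        by (blast intro: finite_UnionD finite_subset)+
    qed
    moreover have "card (K1 \<union> K2) = card K1 + card K2"
    proof (rule card_Un_disjoint)
      show "K1 \<inter> K2 = {}" using no_common[OF UK ne(2)] .
      have "\<Union>K1 \<subseteq> X" "\<Union>K2 \<subseteq> Y" using K1X K2Y by blast+
      thus "finite K1" "finite K2" using \<open>finite X\<close> \<open>finite Y\<close>
        by (blast intro: finite_UnionD finite_subset)+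
    qed
    moreover have "card (U1 \<union> U2) = card U1 + card U2"
    proof (rule card_Un_disjoint)
      show "finite U1" "finite U2" using U12 \<open>finite X\<close> \<open>finite Y\<close> finite_subset by blast+
      show "U1 \<inter> U2 = {}" using U12 dXY by blast
    qed
    moreover have "card W = card X + card Y"
      using XY dXY \<open>finite X\<close> \<open>finite Y\<close> card_Un_disjoint by blast
    ultimately show ?thesis using 1(3) 2(3) by (intro exI[of _ "M1 \<union> M2"] exI[of _ "U1 \<union> U2"] exI[of _ "K1 \<union> K2"]) simp
  next
    case ess
    then obtain v where ess: "v \<in> W" "\<And>N. max_matching E N \<Longrightarrow> v \<in> \<Union>N" by (meson bexE)
    define E' where "E' = {e \<in> E. v \<notin> e}"
    have "card (W - {v}) < card W" by (rule card_Diff1_less[OF W ess(1)])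
    moreover have "\<forall>e\<in>E'. e \<subseteq> W - {v} \<and> card e = 2" using E by (auto simp: E'_def)
    ultimately obtain M' U \<K> where
      IH: "matching E' M'" "odd_barrier (W - {v}) E' U \<K>"
        "card (W - {v}) + card U \<le> 2 * card M' + card \<K>"
      using less.hyps[of "W - {v}" E'] W by blast
    obtain M where M: "max_matching E M" using max_matching_exists[OF fin] by blast
    have M'E: "matching E M'" "v \<notin> \<Union>M'" using IH(1) by (auto simp: matching_def E'_def)
    hence "\<not> max_matching E M'" using ess(2) by blast
    with M M'E have "card M' < card M"
      unfolding max_matching_def using le_neq_implies_less order_trans by (metis not_less)
    moreover have "v \<notin> U" using IH(2) by (auto simp: odd_barrier_def)
    moreover have "finite U" using IH(2) W by (auto simp: odd_barrier_def intro: finite_subset)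
    moreover have "odd_barrier W E (insert v U) \<K>"
      unfolding odd_barrier_def
    proof (intro conjI ballI impI)
      fix e K assume eK: "e \<in> E" "K \<in> \<K>" "e \<inter> K \<noteq> {}"
      show "e \<subseteq> K \<union> insert v U"
      proof (cases "v \<in> e")
        case True
        moreover have "card e = 2" using two eK(1) by blast
        ultimately obtain y where y: "e = {v, y}" using card_2_other by metis
        moreover have "v \<notin> K" using IH(2) eK by (auto simp: odd_barrier_def)
        ultimately show ?thesis using eK(3) y by blast
      next
        case False
        hence "e \<in> E'" using eK by (simp add: E'_def)
        thus ?thesis using IH(2) eK unfolding odd_barrier_def by blast
      qed
    qed (use IH(2) ess in \<open>auto simp: odd_barrier_def\<close>)
    moreover have "matching E M" using M by (simp add: max_matching_def)
    moreover have "card W = Suc (card (W - {v}))" using card_Suc_Diff1[OF W ess(1)] by simp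
    ultimately show ?thesis using IH(3)
      by (intro exI[of _ M] exI[of _ "insert v U"] exI[of _ \<K>]) simp
  next
    case crit
    note conn = crit(2)
    have missed: "\<exists>N. max_matching E N \<and> v \<notin> \<Union>N" if "v \<in> W" for v
      using crit(3) that by meson
    obtain w where w: "w \<in> W" using crit(1) by blast
    \<comment> \<open>The class of \<open>w\<close> under the relation of never being missed together is closed under adjacency.\<close>
    define X where "X = {x \<in> W. x = w \<or> (\<forall>N. max_matching E N \<longrightarrow> w \<in> \<Union>N \<or> x \<in> \<Union>N)}"
    have "X \<subseteq> W" "X \<noteq> {}" using w by (auto simp: X_def)
    moreover have "\<forall>e\<in>E. e \<inter> X \<noteq> {} \<longrightarrow> e \<subseteq> X"
    proof (intro ballI impI subsetI)
      fix e y assume e: "e \<in> E" "e \<inter> X \<noteq> {}" "y \<in> e"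
      then obtain x where x: "x \<in> e" "x \<in> X" by blast
      show "y \<in> X"
      proof (cases "y = x")
        case False
        hence exy: "e = {x, y}" using two e(1,3) x(1) card_2_other by (metis insertE singletonD)
        have adj: "x \<in> \<Union>N \<or> y \<in> \<Union>N" if N: "max_matching E N" for N
        proof (rule ccontr)
          assume no: "\<not> (x \<in> \<Union>N \<or> y \<in> \<Union>N)"
          hence "matching E (insert e N)" using N e(1) exy
            unfolding max_matching_def matching_def by (auto simp: pairwise_insert disjnt_def)
          hence "card (insert e N) \<le> card N" using N by (auto simp: max_matching_def)
          moreover have "e \<notin> N" using no exy by blast
          ultimately show False using finite_matching[OF fin] N by (simp add: max_matching_def)
        qed
        have "y \<in> W" "x \<in> W" using e(1,3) x E by blast+
        show ?thesis
        proof (cases "x = w \<or> y = w")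
          case True thus ?thesis using adj \<open>y \<in> W\<close> by (auto simp: X_def)
        next
          case False
          hence "\<And>N. max_matching E N \<Longrightarrow> w \<in> \<Union>N \<or> x \<in> \<Union>N" using x(2) by (auto simp: X_def)
          hence "w \<in> \<Union>N \<or> y \<in> \<Union>N" if "max_matching E N" for N
            using gallai_exchange[OF fin two missed[OF \<open>x \<in> W\<close>], of w y N] adj that False by blast
          thus ?thesis using \<open>y \<in> W\<close> by (auto simp: X_def)
        qed
      qed (use x in simp)
    qed
    ultimately have "X = W" using conn by meson
    obtain M where M: "max_matching E M" "w \<notin> \<Union>M" using missed[OF w] by blast
    have mM: "matching E M" using M by (simp add: max_matching_def)
    have sub: "\<Union>M \<subseteq> W" using mM E by (auto simp: matching_def)
    have "W - {w} \<subseteq> \<Union>M" using M \<open>X = W\<close> unfolding X_def by blast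
    hence "\<Union>M = W - {w}" using M(2) sub by blast
    hence "2 * card M = card (W - {w})" using card_Union_matching[OF fin two mM] by simp
    moreover have "card W = Suc (card (W - {w}))" using card_Suc_Diff1[OF W w] by simp
    ultimately have c: "card W = Suc (2 * card M)" by simp
    have "odd_barrier W E {} {W}" using c E by (auto simp: odd_barrier_def)
    thus ?thesis using mM c by (intro exI[of _ M] exI[of _ "{}"] exI[of _ "{W}"]) simp
  qed
qed

text \<open>
  Links may be parallel, hence the index set. If \<open>U\<close> and \<open>\<K>\<close> form an odd barrier, each member of \<open>\<K>\<close>
  receives weight at least \<open>1\<close> over links that all have their other end in \<open>U\<close>, and the links
  at \<open>U\<close> have total weight at most \<open>card U\<close>. So \<open>card \<K> \<le> card U\<close>, and \<open>tutte_berge\<close> provides a matching that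
  covers everything.
\<close>
lemma edmonds_fractional_matching:
  fixes p q :: "'i \<Rightarrow> 'a" and w :: "'i \<Rightarrow> real"
  assumes W: "finite W" and I: "finite I"
    and pq: "\<And>i. i \<in> I \<Longrightarrow> p i \<in> W \<and> q i \<in> W \<and> p i \<noteq> q i \<and> 0 \<le> w i"
    and star: "\<And>a. a \<in> W \<Longrightarrow> (\<Sum>i\<in>I. w i * (of_bool (p i = a) + of_bool (q i = a))) = 1"
    and cut: "\<And>K. K \<subseteq> W \<Longrightarrow> odd (card K) \<Longrightarrow> 1 \<le> (\<Sum>i\<in>I. w i * of_bool ((p i \<in> K) \<noteq> (q i \<in> K)))"
  shows "\<exists>M. matching ((\<lambda>i. {p i, q i}) ` I) M \<and> \<Union>M = W"
proof -
  let ?E = "(\<lambda>i. {p i, q i}) ` I"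
  have E: "\<forall>e\<in>?E. e \<subseteq> W \<and> card e = 2" using pq by auto
  obtain M U \<K> where M: "matching ?E M" and b: "odd_barrier W ?E U \<K>"
    and c: "card W + card U \<le> 2 * card M + card \<K>"
    using tutte_berge[OF W E] by blast
  have KW: "K \<subseteq> W - U" if "K \<in> \<K>" for K using b that by (auto simp: odd_barrier_def)
  have finK: "finite \<K>" using W b by (auto simp: odd_barrier_def intro!: finite_UnionD intro: finite_subset)
  have UW: "U \<subseteq> W" using b by (simp add: odd_barrier_def)
  have finU: "finite U" using UW W finite_subset by blast
  have count: "(\<Sum>K\<in>\<K>. of_bool ((p i \<in> K) \<noteq> (q i \<in> K))) \<le> (\<Sum>u\<in>U. of_bool (p i = u) + of_bool (q i = u) :: real)"
    (is "?l \<le> ?r") if i: "i \<in> I" for i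
  proof (cases "\<exists>K\<in>\<K>. (p i \<in> K) \<noteq> (q i \<in> K)")
    case True
    then obtain K where K: "K \<in> \<K>" "(p i \<in> K) \<noteq> (q i \<in> K)" by blast
    have inKU: "{p i, q i} \<subseteq> K \<union> U" using b K i unfolding odd_barrier_def by (metis (no_types, lifting) disjoint_iff image_eqI insert_iff)
    have only: "K' = K" if K': "K' \<in> \<K>" "(p i \<in> K') \<noteq> (q i \<in> K')" for K'
    proof (rule ccontr)
      assume "K' \<noteq> K"
      hence "K \<inter> K' = {}" using b K K' by (auto simp: odd_barrier_def pairwise_def disjnt_def)
      thus False using inKU KW[OF K(1)] KW[OF K'(1)] K K' by blast
    qed
    have iff: "((p i \<in> K') \<noteq> (q i \<in> K')) = (K' = K)" if "K' \<in> \<K>" for K'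
      using only[OF that] K(2) by blast
    have "?l = (\<Sum>K'\<in>\<K>. of_bool (K' = K))"
      by (rule sum.cong[OF refl]) (simp only: iff)
    also have "\<dots> = 1" using K finK by (simp add: sum.delta of_bool_def)
    also have "\<dots> \<le> ?r"
    proof -
      obtain u where u: "u \<in> U" "u = p i \<or> u = q i" using inKU K by blast
      have "of_bool (p i = u) + of_bool (q i = u) \<le> ?r"
        using u finU by (intro member_le_sum) auto
      thus ?thesis using u by (auto split: if_splits simp: of_bool_def)
    qed
    finally show ?thesis .
  next
    case False
    hence "?l = 0" by (intro sum.neutral) auto
    thus ?thesis by (simp add: sum_nonneg)
  qed
  have "real (card \<K>) = (\<Sum>K\<in>\<K>. 1)" by simp
  also have "\<dots> \<le> (\<Sum>K\<in>\<K>. \<Sum>i\<in>I. w i * of_bool ((p i \<in> K) \<noteq> (q i \<in> K)))"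
  proof (rule sum_mono)
    fix K assume K: "K \<in> \<K>"
    show "1 \<le> (\<Sum>i\<in>I. w i * of_bool ((p i \<in> K) \<noteq> (q i \<in> K)))"
      using b K KW[OF K] by (intro cut) (auto simp: odd_barrier_def)
  qed
  also have "\<dots> = (\<Sum>i\<in>I. w i * (\<Sum>K\<in>\<K>. of_bool ((p i \<in> K) \<noteq> (q i \<in> K))))"
    by (subst sum.swap) (simp only: sum_distrib_left)
  also have "\<dots> \<le> (\<Sum>i\<in>I. w i * (\<Sum>u\<in>U. of_bool (p i = u) + of_bool (q i = u)))"
    using count pq by (intro sum_mono mult_left_mono) blast+
  also have "\<dots> = (\<Sum>u\<in>U. \<Sum>i\<in>I. w i * (of_bool (p i = u) + of_bool (q i = u)))"
    by (subst sum.swap) (simp only: sum_distrib_left)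
  also have "\<dots> = (\<Sum>u\<in>U. 1)" using star UW by (intro sum.cong) auto
  finally have "card \<K> \<le> card U" by simp
  hence "card W \<le> 2 * card M" using c by simp
  moreover have "finite (\<Union>?E)" using I by auto
  hence "card (\<Union>M) = 2 * card M" using card_Union_matching M E by blast
  moreover have "\<Union>M \<subseteq> W" using M E by (auto simp: matching_def)
  ultimately have "\<Union>M = W" using W card_seteq by metis
  thus ?thesis using M by blast
qed

section \<open>Integer lifts of modulo 3 orientations\<close>

definition one_edge_cut :: "('v, 'e) sgraph \<Rightarrow> 'v set \<Rightarrow> 'e \<Rightarrow> bool" where
  "one_edge_cut G S e \<longleftrightarrow>
    {e' \<in> edges G. (ends G (e', False) \<in> S) \<noteq> (ends G (e', True) \<in> S)} = {e}"

lemma Plus_iff: "Inl a \<in> A <+> B \<longleftrightarrow> a \<in> A" "Inr b \<in> A <+> B \<longleftrightarrow> b \<in> B"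
  by auto

lemma sum_half_edges:
  "sum F (half_edges G) = (\<Sum>e\<in>edges G. F (e, False) + F (e, True))"
proof -
  have "sum F (half_edges G) = (\<Sum>e\<in>edges G. \<Sum>b\<in>UNIV. F (e, b))"
    unfolding half_edges_def by (simp add: sum.cartesian_product)
  thus ?thesis by (simp add: UNIV_bool add.commute)
qed

lemma sum_half_edges_by_vertex:
  assumes "signed_graph G"
  shows "sum F (half_edges G) = (\<Sum>v\<in>verts G. sum F (half_edges_at G v))"
proof -
  have "(\<Sum>v\<in>verts G. sum F {h \<in> half_edges G. ends G h = v}) = sum F (half_edges G)"
    using assms by (intro sum.group) (auto simp: signed_graph_def half_edges_def)
  thus ?thesis by (simp add: half_edges_at_def)
qed

text \<open>
  A signed graph on which the constant \<open>1\<close> is a flow modulo \<open>3\<close> for the orientation \<open>\<tau>\<close>, and in which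
  no set of vertices is left by exactly one edge.
\<close>
locale mod3_orientation =
  fixes G :: "('v, 'e) sgraph" and \<tau> :: "'e \<times> bool \<Rightarrow> int"
  assumes sg: "signed_graph G" and orient: "orientation G \<tau>"
    and mod3: "v \<in> verts G \<Longrightarrow> 3 dvd (\<Sum>h\<in>half_edges_at G v. \<tau> h)"
    and no_cut: "\<not> one_edge_cut G S e"
begin

definition load :: "'e \<times> bool \<Rightarrow> nat" where
  "load h = (if \<tau> h = 1 then 1 else 2)"

definition demand :: "'v \<Rightarrow> nat" where
  "demand v = (\<Sum>h\<in>half_edges_at G v. load h) div 3"

definition neg_edges :: "'e set" where
  "neg_edges = {e \<in> edges G. signature G e = -1}"

text \<open>
  The gadget has one node for a positive edge and two for a negative edge, one per half-edge, and
  \<open>demand v\<close> copies of each vertex \<open>v\<close>. The node of a half-edge is linked to all copies of its end,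
  and the two nodes of a negative edge are linked to each other. A half-edge is selected when its node
  is matched to a copy of its end: for a positive edge this selects exactly one half, and for a
  negative edge either both halves or, if its two nodes are matched together, none.
\<close>
definition node :: "'e \<times> bool \<Rightarrow> 'e \<times> bool" where
  "node h = (if signature G (fst h) = 1 then (fst h, False) else h)"

definition nodes :: "('e \<times> bool) set" where
  "nodes = (SIGMA e:edges G. if signature G e = 1 then {False} else UNIV)"

definition gadget :: "('e \<times> bool + 'v \<times> nat) set" where
  "gadget = nodes <+> (SIGMA v:verts G. {..<demand v})"

definition links :: "(('e \<times> bool) \<times> nat + 'e) set" where
  "links = (SIGMA h:half_edges G. {..<demand (ends G h)}) <+> neg_edges"

definition link_src :: "('e \<times> bool) \<times> nat + 'e \<Rightarrow> 'e \<times> bool + 'v \<times> nat" where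
  "link_src = case_sum (\<lambda>(h, j). Inl (node h)) (\<lambda>e. Inl (e, False))"

definition link_dst :: "('e \<times> bool) \<times> nat + 'e \<Rightarrow> 'e \<times> bool + 'v \<times> nat" where
  "link_dst = case_sum (\<lambda>(h, j). Inr (ends G h, j)) (\<lambda>e. Inl (e, True))"

text \<open>
  A third of the load of a half-edge is spread evenly over the copies of its end; what a node of a
  negative edge lacks to total weight \<open>1\<close> goes to the link between the two nodes.
\<close>
definition link_weight :: "('e \<times> bool) \<times> nat + 'e \<Rightarrow> real" where
  "link_weight = case_sum (\<lambda>(h, j). real (load h) / (3 * real (demand (ends G h))))
     (\<lambda>e. (3 - real (load (e, False))) / 3)"

lemma fin: "finite (verts G)" "finite (edges G)" "finite (half_edges G)" "finite (half_edges_at G v)"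
  using sg by (auto simp: signed_graph_def half_edges_def half_edges_at_def)

lemma sign_cases:
  assumes "e \<in> edges G"
  obtains (pos) "signature G e = 1" | (neg) "signature G e = -1"
  using assms sg by (auto simp: signed_graph_def)

lemma tau_cases:
  assumes "h \<in> half_edges G"
  shows "\<tau> h = 1 \<or> \<tau> h = -1"
  using assms orient by (auto simp: orientation_def)

lemma tau_opposite:
  assumes "e \<in> edges G"
  shows "\<tau> (e, True) = - signature G e * \<tau> (e, False)"
proof -
  have "(e, False) \<in> half_edges G" using assms by (simp add: half_edges_def)
  hence "\<tau> (e, False) \<in> {-1, 1}" "\<tau> (e, False) * \<tau> (e, True) = - signature G e"
    using orient unfolding orientation_def by (force simp: opp_def)+
  thus ?thesis by auto
qed

lemma load_12: "load h = 1 \<or> load h = 2" by (simp add: load_def)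

lemma load_neg:
  assumes "e \<in> edges G" "signature G e = -1"
  shows "load (e, True) = load (e, False)"
  using tau_opposite[OF assms(1)] assms(2) by (simp add: load_def)

lemma load_pos:
  assumes "e \<in> edges G" "signature G e = 1"
  shows "load (e, True) = 3 - load (e, False)"
  using tau_opposite[OF assms(1)] tau_cases[of "(e, False)"] assms
  by (auto simp: load_def half_edges_def)

text \<open>
  The load of a half-edge is congruent to \<open>\<tau>\<close> modulo \<open>3\<close>, so no rounding occurs in the definition of \<open>demand\<close>.
\<close>
lemma demand_sum:
  assumes "v \<in> verts G"
  shows "3 * demand v = (\<Sum>h\<in>half_edges_at G v. load h)"
proof -
  have "int (load h) - \<tau> h = (if \<tau> h = 1 then 0 else 3)" if "h \<in> half_edges_at G v" for h
    using that tau_cases[of h] by (auto simp: load_def half_edges_at_def)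
  hence "(\<Sum>h\<in>half_edges_at G v. int (load h) - \<tau> h) = (\<Sum>h\<in>half_edges_at G v. if \<tau> h = 1 then 0 else 3)"
    by (intro sum.cong) auto
  moreover have "3 dvd (\<Sum>h\<in>half_edges_at G v. if \<tau> h = 1 then 0 else (3::int))"
    by (intro dvd_sum) auto
  ultimately have "3 dvd (\<Sum>h\<in>half_edges_at G v. int (load h) - \<tau> h)" by (simp only:)
  hence "3 dvd (\<Sum>h\<in>half_edges_at G v. int (load h) - \<tau> h) + (\<Sum>h\<in>half_edges_at G v. \<tau> h)"
    by (rule dvd_add[OF _ mod3[OF assms]])
  hence "(3::int) dvd int (\<Sum>h\<in>half_edges_at G v. load h)" by (simp add: sum_subtractf)
  hence "3 dvd (\<Sum>h\<in>half_edges_at G v. load h)" by (metis int_dvd_int_iff of_nat_numeral)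
  thus ?thesis by (simp add: demand_def)
qed

lemma ends_verts: "h \<in> half_edges G \<Longrightarrow> ends G h \<in> verts G"
  using sg by (auto simp: signed_graph_def)

lemma demand_pos:
  assumes "h \<in> half_edges G"
  shows "0 < demand (ends G h)"
proof -
  have "load h \<le> (\<Sum>h'\<in>half_edges_at G (ends G h). load h')"
    using assms fin by (intro member_le_sum) (auto simp: half_edges_at_def)
  thus ?thesis using load_12[of h] demand_sum[OF ends_verts[OF assms]] by auto
qed

lemma gadget_iff [simp]:
  "Inl n \<in> gadget \<longleftrightarrow> n \<in> nodes"
  "Inr (v, j) \<in> gadget \<longleftrightarrow> v \<in> verts G \<and> j < demand v"
  by (simp_all add: gadget_def Plus_iff)

lemma links_iff [simp]:
  "Inl (h, j) \<in> links \<longleftrightarrow> h \<in> half_edges G \<and> j < demand (ends G h)"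
  "Inr e \<in> links \<longleftrightarrow> e \<in> neg_edges"
  by (simp_all add: links_def Plus_iff)

lemma finite_nodes: "finite nodes"
  unfolding nodes_def by (rule finite_SigmaI[OF fin(2)]) simp

lemma finite_gadget: "finite gadget"
  unfolding gadget_def by (intro finite_Plus finite_SigmaI fin finite_nodes finite_lessThan)

lemma finite_links: "finite links"
  unfolding links_def neg_edges_def
  by (intro finite_Plus finite_SigmaI fin finite_lessThan finite_Collect_conjI disjI1) (simp add: fin)

lemma node_in_nodes: "h \<in> half_edges G \<Longrightarrow> node h \<in> nodes"
  by (auto simp: node_def nodes_def half_edges_def)

lemma link_ends:
  assumes "i \<in> links"
  shows "link_src i \<in> gadget \<and> link_dst i \<in> gadget \<and> link_src i \<noteq> link_dst i \<and> 0 \<le> link_weight i"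
proof (cases i)
  case (Inl x)
  then obtain h j where h: "i = Inl (h, j)" "h \<in> half_edges G" "j < demand (ends G h)"
    using assms by (cases x) simp
  thus ?thesis
    using node_in_nodes[OF h(2)] ends_verts[OF h(2)]
    by (simp add: link_src_def link_dst_def link_weight_def)
next
  case (Inr e)
  hence "e \<in> neg_edges" using assms by simp
  hence "(e, False) \<in> nodes" "(e, True) \<in> nodes" by (auto simp: nodes_def neg_edges_def)
  thus ?thesis using Inr load_12[of "(e, False)"]
    by (elim disjE) (simp_all add: link_src_def link_dst_def link_weight_def)
qed

lemma sum_links:
  fixes F :: "_ \<Rightarrow> _ \<Rightarrow> real"
  shows "(\<Sum>i\<in>links. link_weight i * F (link_src i) (link_dst i)) =
    (\<Sum>h\<in>half_edges G. real (load h) / (3 * real (demand (ends G h))) *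
       (\<Sum>j<demand (ends G h). F (Inl (node h)) (Inr (ends G h, j)))) +
    (\<Sum>e\<in>neg_edges. (3 - real (load (e, False))) / 3 * F (Inl (e, False)) (Inl (e, True)))"
proof -
  have "finite neg_edges" using fin by (simp add: neg_edges_def)
  hence "(\<Sum>i\<in>links. link_weight i * F (link_src i) (link_dst i)) =
     (\<Sum>(h, j)\<in>(SIGMA h:half_edges G. {..<demand (ends G h)}). real (load h) / (3 * real (demand (ends G h))) *
       F (Inl (node h)) (Inr (ends G h, j))) +
    (\<Sum>e\<in>neg_edges. (3 - real (load (e, False))) / 3 * F (Inl (e, False)) (Inl (e, True)))"
    unfolding links_def using fin
    by (subst sum.Plus) (auto simp: link_src_def link_dst_def link_weight_def case_prod_beta comp_def)
  thus ?thesis using fin by (simp add: sum.Sigma[symmetric] sum_distrib_left)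
qed

lemma sum_load_at:
  assumes "v \<in> verts G" "0 < demand v"
  shows "(\<Sum>h\<in>half_edges_at G v. real (load h) / (3 * real (demand v))) = 1"
proof -
  have "(\<Sum>h\<in>half_edges_at G v. real (load h) / (3 * real (demand v)))
      = real (\<Sum>h\<in>half_edges_at G v. load h) / (3 * real (demand v))"
    by (simp add: sum_divide_distrib)
  thus ?thesis using assms by (simp add: demand_sum[symmetric])
qed

lemma star_sum:
  assumes "a \<in> gadget"
  shows "(\<Sum>i\<in>links. link_weight i * (of_bool (link_src i = a) + of_bool (link_dst i = a))) = 1"
proof (cases a)
  case (Inl n)
  hence nn: "n \<in> nodes" using assms by simp
  obtain e b where n: "n = (e, b)" "e \<in> edges G" "signature G e = 1 \<Longrightarrow> b = False"
  proof
    show "n = (fst n, snd n)" "fst n \<in> edges G" using nn by (auto simp: nodes_def)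
    show "snd n = False" if "signature G (fst n) = 1" using nn that by (cases n) (simp add: nodes_def)
  qed
  have half: "real (load h) / (3 * real (demand (ends G h))) *
       (\<Sum>j<demand (ends G h). of_bool (Inl (node h) = a) + of_bool (Inr (ends G h, j) = a)) =
       real (load h) / 3 * of_bool (node h = n)" if "h \<in> half_edges G" for h
    using demand_pos[OF that] Inl by simp
  have "(\<Sum>i\<in>links. link_weight i * (of_bool (link_src i = a) + of_bool (link_dst i = a))) =
      (\<Sum>h\<in>half_edges G. real (load h) / 3 * of_bool (node h = n)) +
      (\<Sum>e\<in>neg_edges. (3 - real (load (e, False))) / 3 * (of_bool ((e, False) = n) + of_bool ((e, True) = n)))"
  proof (subst sum_links, intro arg_cong2[of _ _ _ _ "(+)"] sum.cong[OF refl])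
    fix e' assume "e' \<in> neg_edges"
    show "(3 - real (load (e', False))) / 3 * (of_bool (Inl (e', False) = a) + of_bool (Inl (e', True) = a)) =
      (3 - real (load (e', False))) / 3 * (of_bool ((e', False) = n) + of_bool ((e', True) = n))"
      using Inl by simp
  qed (rule half)
  also have "(\<Sum>h\<in>half_edges G. real (load h) / 3 * of_bool (node h = n)) =
     (\<Sum>e'\<in>edges G. if e' = e then (if signature G e = 1 then 1 else real (load n) / 3) else 0)"
  proof (subst sum_half_edges, rule sum.cong[OF refl])
    fix e' assume e': "e' \<in> edges G"
    show "real (load (e', False)) / 3 * of_bool (node (e', False) = n) +
         real (load (e', True)) / 3 * of_bool (node (e', True) = n) =
         (if e' = e then (if signature G e = 1 then 1 else real (load n) / 3) else 0)"
    proof (cases "signature G e = 1")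
      case True
      thus ?thesis using n load_pos[OF n(2) True] load_12[of "(e, False)"]
        by (auto simp: node_def)
    next
      case False
      thus ?thesis using n by (cases b) (auto simp: node_def)
    qed
  qed
  also have "\<dots> = (if signature G e = 1 then 1 else real (load n) / 3)" using n(2) fin by (simp add: sum.delta)
  also have "(\<Sum>e\<in>neg_edges. (3 - real (load (e, False))) / 3 * (of_bool ((e, False) = n) + of_bool ((e, True) = n)))
     = (\<Sum>e'\<in>neg_edges. if e' = e then (3 - real (load (e, False))) / 3 else 0)"
    using n by (intro sum.cong[OF refl]) (cases b; auto)
  also have "\<dots> = (if e \<in> neg_edges then (3 - real (load (e, False))) / 3 else 0)"
    using fin by (simp add: sum.delta neg_edges_def)
  finally have total: "(\<Sum>i\<in>links. link_weight i * (of_bool (link_src i = a) + of_bool (link_dst i = a))) =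
    (if signature G e = 1 then 1 else real (load n) / 3) +
    (if e \<in> neg_edges then (3 - real (load (e, False))) / 3 else 0)" .
  show ?thesis using n(2)
  proof (cases e rule: sign_cases)
    case pos
    thus ?thesis unfolding total by (simp add: neg_edges_def)
  next
    case neg
    have "load n = load (e, False)" using n(1) load_neg[OF n(2) neg] by (cases b) simp_all
    thus ?thesis using neg n(2) unfolding total by (simp add: neg_edges_def field_simps)
  qed
next
  case (Inr d)
  then obtain v j where d: "a = Inr (v, j)" "v \<in> verts G" "j < demand v"
    using assms by (cases d) simp
  have star: "real (load h) / (3 * real (demand (ends G h))) *
       (\<Sum>i<demand (ends G h). of_bool (Inl (node h) = a) + of_bool (Inr (ends G h, i) = a)) =
      (if ends G h = v then real (load h) / (3 * real (demand v)) else 0)" for h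
  proof -
    have "(\<Sum>i<demand (ends G h). of_bool (Inl (node h) = a) + of_bool (Inr (ends G h, i) = a)) =
        (\<Sum>i<demand (ends G h). if i = j then of_bool (ends G h = v) else 0 :: real)"
      using d(1) by (intro sum.cong) auto
    also have "\<dots> = of_bool (ends G h = v)"
      using d(3) by (subst sum.delta) auto
    finally show ?thesis by simp
  qed
  have "(\<Sum>e\<in>neg_edges. (3 - real (load (e, False))) / 3 *
      (of_bool (Inl (e, False) = a) + of_bool (Inl (e, True) = a))) = 0"
    using d(1) by simp
  hence "(\<Sum>i\<in>links. link_weight i * (of_bool (link_src i = a) + of_bool (link_dst i = a))) =
      (\<Sum>h\<in>half_edges G. if ends G h = v then real (load h) / (3 * real (demand v)) else 0)"
    by (subst sum_links) (simp only: star add_0_right)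
  also have "\<dots> = 1"
    using sum_load_at[OF d(2)] d(3) fin by (simp add: sum.inter_filter[symmetric] half_edges_at_def)
  finally show ?thesis .
qed

text \<open>
  If \<open>K\<close> contains some but not all copies of a vertex \<open>v\<close>, then every half-edge at \<open>v\<close> has a
  crossing link to one of the copies, and these links have total weight at least \<open>1\<close>.

  Otherwise let \<open>S\<close> be the set of vertices with all their copies in \<open>K\<close>. The weight of the cut is a third
  of the sum of the integers \<open>crossing e\<close>: walk from one end of \<open>e\<close> through its nodes to the other end
  and add up, in thirds, the weights of the steps that cross the border of \<open>K\<close>. Since consecutive steps of this
  path have integral weights that add up to \<open>3\<close> at each node, \<open>crossing e\<close> is congruent modulo \<open>2\<close> to the number of
  nodes of \<open>e\<close> in \<open>K\<close> plus the load of the half-edges of \<open>e\<close> at \<open>S\<close>. Summation over all edges shows that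
  the total is congruent to \<open>card K\<close>, hence odd. A total of \<open>1\<close> would mean a single edge \<open>e\<close> with
  \<open>crossing e = 1\<close> and all others \<open>0\<close>, and then \<open>e\<close> alone joins \<open>S\<close> to its complement. So the
  total is at least \<open>3\<close>.
\<close>
lemma odd_cut:
  assumes K: "K \<subseteq> gadget" "odd (card K)"
  shows "1 \<le> (\<Sum>i\<in>links. link_weight i * of_bool ((link_src i \<in> K) \<noteq> (link_dst i \<in> K)))"
proof -
  define q where "q h \<longleftrightarrow> Inl (node h) \<in> K" for h
  define C where "C v = {j. j < demand v \<and> Inr (v, j) \<in> K}" for v
  have finC: "finite (C v)" for v by (simp add: C_def)
  have C_sub: "C v \<subseteq> {..<demand v}" for v by (auto simp: C_def)
  have C_le: "card (C v) \<le> demand v" for v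
    using card_mono[OF finite_lessThan C_sub[of v]] by simp
  have cost: "(\<Sum>i\<in>links. link_weight i * of_bool ((link_src i \<in> K) \<noteq> (link_dst i \<in> K))) =
    (\<Sum>h\<in>half_edges G. real (load h) / (3 * real (demand (ends G h))) *
       real (if q h then demand (ends G h) - card (C (ends G h)) else card (C (ends G h)))) +
    (\<Sum>e\<in>neg_edges. (3 - real (load (e, False))) / 3 * of_bool (q (e, False) \<noteq> q (e, True)))"
    (is "?cut = ?H + ?N")
  proof (subst sum_links, intro arg_cong2[of _ _ _ _ "(+)"] sum.cong refl arg_cong2[of _ _ _ _ "(*)"])
    fix h
    let ?v = "ends G h"
    have "(\<Sum>j<demand ?v. of_bool (q h \<noteq> (Inr (?v, j) \<in> K))) =
        real (card {j \<in> {..<demand ?v}. q h \<noteq> (Inr (?v, j) \<in> K)})"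
      by (simp add: sum.inter_filter[symmetric] of_bool_def)
    also have "{j \<in> {..<demand ?v}. q h \<noteq> (Inr (?v, j) \<in> K)} =
        (if q h then {..<demand ?v} - C ?v else C ?v)" by (auto simp: C_def)
    also have "card \<dots> = (if q h then demand ?v - card (C ?v) else card (C ?v))"
      using C_sub by (simp add: card_Diff_subset finC)
    finally show "(\<Sum>j<demand ?v. of_bool ((Inl (node h) \<in> K) \<noteq> (Inr (?v, j) \<in> K))) =
        real (if q h then demand ?v - card (C ?v) else card (C ?v))"
      by (simp add: q_def)
  next
    fix e assume "e \<in> neg_edges"
    thus "of_bool ((Inl (e, False) \<in> K) \<noteq> (Inl (e, True) \<in> K)) = (of_bool (q (e, False) \<noteq> q (e, True)) :: real)"
      by (auto simp: q_def node_def neg_edges_def)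
  qed
  have N_nonneg: "0 \<le> ?N"
    by (intro sum_nonneg mult_nonneg_nonneg divide_nonneg_nonneg) (simp_all add: load_def)
  show ?thesis
  proof (cases "\<exists>v\<in>verts G. 0 < card (C v) \<and> card (C v) < demand v")
    case True
    then obtain v where v: "v \<in> verts G" "0 < card (C v)" "card (C v) < demand v" by blast
    have "1 = (\<Sum>h\<in>half_edges_at G v. real (load h) / (3 * real (demand (ends G h))))"
      using sum_load_at[OF v(1)] v by (simp add: half_edges_at_def)
    also have "\<dots> \<le> (\<Sum>h\<in>half_edges_at G v. real (load h) / (3 * real (demand (ends G h))) *
       real (if q h then demand (ends G h) - card (C (ends G h)) else card (C (ends G h))))"
    proof (rule sum_mono)
      fix h assume h: "h \<in> half_edges_at G v"
      have "(1::real) \<le> real (if q h then demand v - card (C v) else card (C v))" using v by auto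
      hence "real (load h) / (3 * real (demand v)) * 1 \<le> real (load h) / (3 * real (demand v)) *
         real (if q h then demand v - card (C v) else card (C v))"
        by (rule mult_left_mono) simp
      moreover have "ends G h = v" using h by (simp add: half_edges_at_def)
      ultimately show "real (load h) / (3 * real (demand (ends G h))) \<le> real (load h) / (3 * real (demand (ends G h))) *
         real (if q h then demand (ends G h) - card (C (ends G h)) else card (C (ends G h)))"
        by (simp only: mult_1_right)
    qed
    also have "\<dots> \<le> ?H"
      using fin by (intro sum_mono2) (auto simp: half_edges_at_def)
    finally show ?thesis using N_nonneg cost by linarith
  next
    case False
    hence ext: "card (C v) = 0 \<or> card (C v) = demand v" if "v \<in> verts G" for v
      using that C_le[of v] by (metis le_neq_implies_less not_gr0)
    define S where "S = {v \<in> verts G. 0 < demand v \<and> card (C v) = demand v}"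
    define s where "s h \<longleftrightarrow> ends G h \<in> S" for h
    define crossing where "crossing e = load (e, False) * of_bool (s (e, False) \<noteq> q (e, False)) +
       load (e, True) * of_bool (s (e, True) \<noteq> q (e, True)) +
       (if signature G e = 1 then 0 else (3 - load (e, False)) * of_bool (q (e, False) \<noteq> q (e, True)))" for e
    define inside where "inside e = of_bool (q (e, False)) +
       (if signature G e = 1 then 0 else of_bool (q (e, True)) :: nat)" for e
    have "?H = (\<Sum>h\<in>half_edges G. real (load h * of_bool (s h \<noteq> q h)) / 3)"
    proof (rule sum.cong[OF refl])
      fix h assume h: "h \<in> half_edges G"
      show "real (load h) / (3 * real (demand (ends G h))) *
         real (if q h then demand (ends G h) - card (C (ends G h)) else card (C (ends G h))) =
         real (load h * of_bool (s h \<noteq> q h)) / 3"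
        using ext[OF ends_verts[OF h]] demand_pos[OF h] ends_verts[OF h]
        by (auto simp: s_def S_def)
    qed
    also have "\<dots> = (\<Sum>e\<in>edges G. real (load (e, False) * of_bool (s (e, False) \<noteq> q (e, False)) +
       load (e, True) * of_bool (s (e, True) \<noteq> q (e, True))) / 3)"
      by (subst sum_half_edges) (simp add: add_divide_distrib)
    finally have H: "?H = \<dots>" .
    have N: "?N = (\<Sum>e\<in>edges G. if signature G e = -1 then
        (3 - real (load (e, False))) / 3 * of_bool (q (e, False) \<noteq> q (e, True)) else 0)"
      unfolding neg_edges_def by (rule sum.inter_filter[OF fin(2)])
    have "?cut = (\<Sum>e\<in>edges G. real (load (e, False) * of_bool (s (e, False) \<noteq> q (e, False)) +
       load (e, True) * of_bool (s (e, True) \<noteq> q (e, True))) / 3 + (if signature G e = -1 then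
        (3 - real (load (e, False))) / 3 * of_bool (q (e, False) \<noteq> q (e, True)) else 0))"
      by (simp only: cost H N sum.distrib)
    also have "\<dots> = (\<Sum>e\<in>edges G. real (crossing e) / 3)"
    proof (rule sum.cong[OF refl])
      fix e assume "e \<in> edges G"
      thus "real (load (e, False) * of_bool (s (e, False) \<noteq> q (e, False)) +
       load (e, True) * of_bool (s (e, True) \<noteq> q (e, True))) / 3 + (if signature G e = -1 then
        (3 - real (load (e, False))) / 3 * of_bool (q (e, False) \<noteq> q (e, True)) else 0) = real (crossing e) / 3"
        using load_12[of "(e, False)"]
        by (cases e rule: sign_cases) (auto simp: crossing_def field_simps)
    qed
    finally have cut: "?cut = real (sum crossing (edges G)) / 3" by (simp add: sum_divide_distrib)
    have parity: "even (crossing e + inside e + (load (e, False) * of_bool (s (e, False)) + load (e, True) * of_bool (s (e, True))))"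
      if "e \<in> edges G" for e
      using that
    proof (cases e rule: sign_cases)
      case pos
      thus ?thesis using load_12[of "(e, False)"] load_pos[OF that pos]
        by (cases "q (e, False)"; cases "s (e, False)"; cases "s (e, True)")
          (auto simp: crossing_def inside_def q_def node_def)
    next
      case neg
      thus ?thesis using load_neg[OF that neg]
        by - (rule disjE[OF load_12[of "(e, False)"]]; cases "q (e, False)"; cases "q (e, True)";
          cases "s (e, False)"; cases "s (e, True)"; simp add: crossing_def inside_def)
    qed
    have "even (\<Sum>e\<in>edges G. crossing e + inside e + (load (e, False) * of_bool (s (e, False)) + load (e, True) * of_bool (s (e, True))))"
      using parity by (intro dvd_sum) auto
    hence even: "even (sum crossing (edges G) + sum inside (edges G) + (\<Sum>h\<in>half_edges G. load h * of_bool (s h)))"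
      by (simp add: sum.distrib sum_half_edges)
    have "(\<Sum>h\<in>half_edges G. load h * of_bool (s h)) = (\<Sum>v\<in>verts G. 3 * (if v \<in> S then demand v else 0))"
    proof (subst sum_half_edges_by_vertex[OF sg], rule sum.cong[OF refl])
      fix v assume "v \<in> verts G"
      have "(\<Sum>h\<in>half_edges_at G v. load h * of_bool (s h)) = (\<Sum>h\<in>half_edges_at G v. load h * of_bool (v \<in> S))"
        by (intro sum.cong) (auto simp: half_edges_at_def s_def)
      thus "(\<Sum>h\<in>half_edges_at G v. load h * of_bool (s h)) = 3 * (if v \<in> S then demand v else 0)"
        using demand_sum[OF \<open>v \<in> verts G\<close>] by simp
    qed
    also have "\<dots> = 3 * (\<Sum>v\<in>verts G. card (C v))"
      unfolding sum_distrib_left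
    proof (rule sum.cong[OF refl])
      fix v assume v: "v \<in> verts G"
      show "3 * (if v \<in> S then demand v else 0) = 3 * card (C v)"
        using ext[OF v] v by (auto simp: S_def)
    qed
    finally have dummies: "(\<Sum>h\<in>half_edges G. load h * of_bool (s h)) = 3 * (\<Sum>v\<in>verts G. card (C v))" .
    have "K = {n \<in> nodes. Inl n \<in> K} <+> (SIGMA v:verts G. C v)" (is "K = ?K")
    proof (rule set_eqI)
      fix a
      show "a \<in> K \<longleftrightarrow> a \<in> ?K"
      proof (cases a)
        case (Inl n)
        thus ?thesis using subsetD[OF K(1), of a] by (auto simp: Plus_iff)
      next
        case (Inr d)
        thus ?thesis using subsetD[OF K(1), of a] by (cases d) (auto simp: Plus_iff C_def)
      qed
    qed
    moreover have "finite {n \<in> nodes. Inl n \<in> K}" "finite (SIGMA v:verts G. C v)"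
      using finite_nodes by (simp, intro finite_SigmaI fin finC)
    hence "card ?K = card {n \<in> nodes. Inl n \<in> K} + (\<Sum>v\<in>verts G. card (C v))"
      using fin(1) finC by (simp add: card_Plus)
    ultimately have "card K = card {n \<in> nodes. Inl n \<in> K} + (\<Sum>v\<in>verts G. card (C v))"
      by (simp only:)
    also have "card {n \<in> nodes. Inl n \<in> K} = (\<Sum>n\<in>nodes. of_bool (Inl n \<in> K))"
      by (simp only: of_bool_def card_eq_sum sum.inter_filter[OF finite_nodes])
    also have "\<dots> = (\<Sum>e\<in>edges G. \<Sum>b\<in>(if signature G e = 1 then {False} else UNIV). of_bool (Inl (e, b) \<in> K))"
      unfolding nodes_def by (subst sum.Sigma) (simp_all add: fin split_def)
    also have "\<dots> = sum inside (edges G)"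
      by (intro sum.cong[OF refl]) (auto simp: inside_def q_def node_def UNIV_bool)
    finally have "odd (sum crossing (edges G))" using even dummies K(2) by simp presburger
    moreover have "sum crossing (edges G) \<noteq> 1"
    proof
      assume one: "sum crossing (edges G) = 1"
      then obtain e where e: "e \<in> edges G" "crossing e = 1" "\<forall>e'\<in>edges G. e' \<noteq> e \<longrightarrow> crossing e' = 0"
        using iffD1[OF sum_eq_1_iff[OF fin(2)] one] by metis
      have zero: "s (e', False) = s (e', True)" if "e' \<in> edges G" "crossing e' = 0" for e'
        using that load_12[of "(e', False)"] load_12[of "(e', True)"]
        by (cases e' rule: sign_cases) (auto simp: crossing_def q_def node_def split: if_splits)
      have "s (e, False) \<noteq> s (e, True)" using e(1)
      proof (cases e rule: sign_cases)
        case pos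
        thus ?thesis using e(2) load_12[of "(e, False)"] load_pos[OF e(1) pos]
          by (cases "q (e, False)"; cases "s (e, False)"; cases "s (e, True)")
            (auto simp: crossing_def q_def node_def)
      next
        case neg
        thus ?thesis using e(2) load_neg[OF e(1) neg]
          by - (rule disjE[OF load_12[of "(e, False)"]]; cases "q (e, False)"; cases "q (e, True)";
            cases "s (e, False)"; cases "s (e, True)"; simp add: crossing_def)
      qed
      hence "one_edge_cut G S e"
        using e zero unfolding one_edge_cut_def s_def by blast
      thus False using no_cut by blast
    qed
    moreover have "3 \<le> n" if "odd n" "n \<noteq> 1" for n :: nat using that by presburger
    ultimately have "3 \<le> sum crossing (edges G)" by blast
    hence "real 3 \<le> real (sum crossing (edges G))" by (simp only: of_nat_le_iff)
    thus ?thesis unfolding cut by (simp del: of_nat_sum)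
  qed
qed

lemma gadget_matching:
  obtains M where "matching ((\<lambda>i. {link_src i, link_dst i}) ` links) M" "\<Union>M = gadget"
  using edmonds_fractional_matching[OF finite_gadget finite_links link_ends star_sum odd_cut] by blast

text \<open>
  Each copy of a vertex is matched to the node of some half-edge at that vertex; \<open>Y\<close> consists of
  these half-edges. The node of a positive loop is shared by two half-edges at the same vertex, so the
  half-edge has to be chosen, which is what \<open>\<phi>\<close> does.
\<close>
lemma half_edge_factor:
  "\<exists>Y. (\<forall>v\<in>verts G. card (Y \<inter> half_edges_at G v) = demand v) \<and>
    (\<forall>e\<in>edges G. ((e, True) \<in> Y \<longleftrightarrow> (e, False) \<in> Y) = (signature G e = -1))"
proof -
  obtain M where M: "matching ((\<lambda>i. {link_src i, link_dst i}) ` links) M" and cover: "\<Union>M = gadget"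
    by (rule gadget_matching)
  have disj: "m = m'" if "m \<in> M" "m' \<in> M" "x \<in> m" "x \<in> m'" for m m' x
    using M that by (auto simp: matching_def pairwise_def disjnt_def)
  have shape: "(\<exists>h j. h \<in> half_edges G \<and> j < demand (ends G h) \<and> m = {Inl (node h), Inr (ends G h, j)})
     \<or> (\<exists>e\<in>neg_edges. m = {Inl (e, False), Inl (e, True)})" if m: "m \<in> M" for m
  proof -
    obtain i where i: "i \<in> links" "m = {link_src i, link_dst i}" using M m by (auto simp: matching_def)
    show ?thesis
    proof (cases i)
      case (Inl x)
      obtain h j where "x = (h, j)" by (cases x)
      thus ?thesis using i Inl
        by (intro disjI1 exI[of _ h] exI[of _ j]) (simp add: link_src_def link_dst_def)
    next
      case (Inr e)
      thus ?thesis using i by (intro disjI2 bexI[of _ e]) (simp_all add: link_src_def link_dst_def)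
    qed
  qed
  have "\<exists>h. h \<in> half_edges_at G v \<and> {Inl (node h), Inr (v, j)} \<in> M"
    if "v \<in> verts G" "j < demand v" for v j
  proof -
    have "Inr (v, j) \<in> gadget" using that by simp
    then obtain m where m: "m \<in> M" "Inr (v, j) \<in> m" using cover by blast
    then obtain h j' where "h \<in> half_edges G" "m = {Inl (node h), Inr (ends G h, j')}"
      using shape[OF m(1)] by auto
    thus ?thesis using m by (intro exI[of _ h]) (auto simp: half_edges_at_def)
  qed
  then obtain \<phi> where \<phi>: "\<And>v j. v \<in> verts G \<Longrightarrow> j < demand v \<Longrightarrow>
      \<phi> v j \<in> half_edges_at G v \<and> {Inl (node (\<phi> v j)), Inr (v, j)} \<in> M"
    by metis
  define Y where "Y = {h. \<exists>v j. v \<in> verts G \<and> j < demand v \<and> h = \<phi> v j}"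
  have dummy_unique: "v = v' \<and> j = j'"
    if "v \<in> verts G" "j < demand v" "v' \<in> verts G" "j' < demand v'" "node (\<phi> v j) = node (\<phi> v' j')" for v j v' j'
  proof -
    have "{Inl (node (\<phi> v j)), Inr (v, j)} = {Inl (node (\<phi> v' j')), Inr (v', j')}"
      using disj[of _ _ "Inl (node (\<phi> v j))"] \<phi>[OF that(1,2)] \<phi>[OF that(3,4)] that(5) by simp
    thus ?thesis by (simp add: doubleton_eq_iff)
  qed
  show ?thesis
  proof (intro exI[of _ Y] conjI ballI)
    fix v assume v: "v \<in> verts G"
    have "Y \<inter> half_edges_at G v = \<phi> v ` {..<demand v}"
    proof
      show "\<phi> v ` {..<demand v} \<subseteq> Y \<inter> half_edges_at G v" using \<phi> v by (auto simp: Y_def)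
      show "Y \<inter> half_edges_at G v \<subseteq> \<phi> v ` {..<demand v}"
      proof
        fix h assume h: "h \<in> Y \<inter> half_edges_at G v"
        then obtain v' j where vj: "v' \<in> verts G" "j < demand v'" "h = \<phi> v' j" by (auto simp: Y_def)
        hence "v' = v" using h \<phi>[OF vj(1,2)] by (auto simp: half_edges_at_def)
        thus "h \<in> \<phi> v ` {..<demand v}" using vj by blast
      qed
    qed
    moreover have "inj_on (\<phi> v) {..<demand v}"
      using dummy_unique[OF v _ v] by (auto simp: inj_on_def)
    ultimately show "card (Y \<inter> half_edges_at G v) = demand v" by (simp add: card_image)
  next
    fix e assume e: "e \<in> edges G"
    have covered: "(\<exists>h\<in>Y. node h = n) \<or> (\<exists>e'\<in>neg_edges. Inl n \<in> {Inl (e', False), Inl (e', True)}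
         \<and> {Inl (e', False), Inl (e', True)} \<in> M)" if n: "n \<in> nodes" for n
    proof -
      have "Inl n \<in> \<Union>M" using n by (simp add: cover)
      then obtain m where m: "m \<in> M" "Inl n \<in> m" by blast
      from shape[OF m(1)] show ?thesis
      proof
        assume "\<exists>h j. h \<in> half_edges G \<and> j < demand (ends G h) \<and> m = {Inl (node h), Inr (ends G h, j)}"
        then obtain h j where h: "h \<in> half_edges G" "j < demand (ends G h)" "m = {Inl (node h), Inr (ends G h, j)}"
          by blast
        let ?h = "\<phi> (ends G h) j"
        note P = \<phi>[OF ends_verts[OF h(1)] h(2)]
        have "{Inl (node ?h), Inr (ends G h, j)} = m"
          using disj[of _ _ "Inr (ends G h, j)"] P m(1) h(3) by simp
        hence "node ?h = n" using h(3) m(2) by auto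
        moreover have "?h \<in> Y" using h ends_verts unfolding Y_def by blast
        ultimately show ?thesis by blast
      qed (use m in blast)
    qed
    have free: "{Inl (e, False), Inl (e, True)} \<notin> M" if hY: "h \<in> Y" "h = (e, b)" "signature G e \<noteq> 1" for h b
    proof
      assume in_M: "{Inl (e, False), Inl (e, True)} \<in> M"
      obtain v j where vj: "v \<in> verts G" "j < demand v" "h = \<phi> v j" using hY(1) by (auto simp: Y_def)
      have "node h = h" using that by (simp add: node_def)
      hence "{Inl h, Inr (v, j)} \<in> M" using \<phi>[OF vj(1,2)] vj(3) by simp
      moreover have "Inl h \<in> {Inl (e, False), Inl (e, True)}" using that by (cases b) auto
      ultimately have "{Inl h, Inr (v, j)} = {Inl (e, False), Inl (e, True)}"
        using disj[OF _ in_M, of "{Inl h, Inr (v, j)}" "Inl h"] by simp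
      thus False by (auto simp: doubleton_eq_iff)
    qed
    show "((e, True) \<in> Y \<longleftrightarrow> (e, False) \<in> Y) = (signature G e = -1)" using e
    proof (cases e rule: sign_cases)
      case pos
      have "(e, False) \<in> nodes" using e by (simp add: nodes_def)
      moreover have "(e, False) \<noteq> (e', False) \<and> (e, False) \<noteq> (e', True)" if "e' \<in> neg_edges" for e'
        using that pos by (auto simp: neg_edges_def)
      ultimately obtain h where h: "h \<in> Y" "node h = (e, False)"
        using covered[of "(e, False)"] by auto
      have "fst h = e" using h(2) by (auto simp: node_def split: if_splits)
      hence "h = (e, False) \<or> h = (e, True)" by (cases h) auto
      hence "(e, False) \<in> Y \<or> (e, True) \<in> Y" using h(1) by blast
      moreover have "\<not> ((e, False) \<in> Y \<and> (e, True) \<in> Y)"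
      proof
        assume "(e, False) \<in> Y \<and> (e, True) \<in> Y"
        then obtain v j v' j' where vj:
          "v \<in> verts G" "j < demand v" "(e, False) = \<phi> v j" "v' \<in> verts G" "j' < demand v'" "(e, True) = \<phi> v' j'"
          by (auto simp: Y_def)
        have "node (\<phi> v j) = node (\<phi> v' j')"
          unfolding vj(3,6)[symmetric] using pos by (simp add: node_def)
        hence "v = v' \<and> j = j'" by (rule dummy_unique[OF vj(1,2,4,5)])
        hence "(e, False) = (e, True)" using vj(3,6) by simp
        thus False by simp
      qed
      ultimately show ?thesis using pos by auto
    next
      case neg
      have other: "(e, \<not> b) \<in> Y" if b: "(e, b) \<in> Y" for b
      proof -
        have "(e, \<not> b) \<in> nodes" using e neg by (simp add: nodes_def)
        moreover have "\<not> (\<exists>e'\<in>neg_edges. Inl (e, \<not> b) \<in> {Inl (e', False), Inl (e', True)}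
         \<and> {Inl (e', False), Inl (e', True)} \<in> M)"
          using free[OF b refl] neg by auto
        ultimately obtain h where h: "h \<in> Y" "node h = (e, \<not> b)" using covered by blast
        hence "h = (e, \<not> b)" using neg by (auto simp: node_def split: if_splits)
        thus ?thesis using h(1) by simp
      qed
      show ?thesis using other[of True] other[of False] neg by auto
    qed
  qed
qed

text \<open>
  With \<open>Y\<close> from \<open>half_edge_factor\<close>, an edge gets the value \<open>-2\<close> when its half-edges with \<open>\<tau> = 1\<close> lie in
  \<open>Y\<close> and those with \<open>\<tau> = -1\<close> do not. The conditions on \<open>Y\<close> make both halves of an edge agree on
  this, and each half-edge then contributes its load, minus \<open>3\<close> if it lies in \<open>Y\<close>, to the
  boundary.
\<close>
theorem mod3_flow_lift:
  "\<exists>g. (\<forall>e. g e = 1 \<or> g e = -2) \<and> (\<forall>v\<in>verts G. (\<Sum>h\<in>half_edges_at G v. \<tau> h * g (fst h)) = 0)"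
proof -
  obtain Y where Y: "\<forall>v\<in>verts G. card (Y \<inter> half_edges_at G v) = demand v"
    "\<forall>e\<in>edges G. ((e, True) \<in> Y \<longleftrightarrow> (e, False) \<in> Y) = (signature G e = -1)"
    using half_edge_factor by blast
  note card_Y = bspec[OF Y(1)] and sym = bspec[OF Y(2)]
  define g where "g e = (if ((e, False) \<in> Y) = (\<tau> (e, False) = 1) then -2 else 1 :: int)" for e
  have half: "\<tau> h * g (fst h) = int (load h) - 3 * of_bool (h \<in> Y)" if h: "h \<in> half_edges G" for h
  proof -
    obtain e b where eb: "h = (e, b)" "e \<in> edges G" using h by (auto simp: half_edges_def)
    have t: "\<tau> (e, False) = 1 \<or> \<tau> (e, False) = -1"
      using tau_cases[of "(e, False)"] eb(2) by (simp add: half_edges_def)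
    show ?thesis
    proof (cases b)
      case False
      thus ?thesis using eb t by (auto simp: g_def load_def)
    next
      case True
      show ?thesis using eb(2)
      proof (cases e rule: sign_cases)
        case pos
        thus ?thesis using True eb t sym[OF eb(2)] tau_opposite[OF eb(2)] by (auto simp: g_def load_def)
      next
        case neg
        thus ?thesis using True eb t sym[OF eb(2)] tau_opposite[OF eb(2)] by (auto simp: g_def load_def)
      qed
    qed
  qed
  have "(\<Sum>h\<in>half_edges_at G v. \<tau> h * g (fst h)) = 0" if v: "v \<in> verts G" for v
  proof -
    have "(\<Sum>h\<in>half_edges_at G v. \<tau> h * g (fst h)) =
        (\<Sum>h\<in>half_edges_at G v. int (load h) - 3 * of_bool (h \<in> Y))"
      using half by (intro sum.cong) (auto simp: half_edges_at_def)
    also have "\<dots> = int (\<Sum>h\<in>half_edges_at G v. load h) - 3 * (\<Sum>h\<in>half_edges_at G v. of_bool (h \<in> Y))"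
      by (simp only: sum_subtractf sum_distrib_left of_nat_sum)
    also have "(\<Sum>h\<in>half_edges_at G v. of_bool (h \<in> Y)) = int (card (Y \<inter> half_edges_at G v))"
    proof -
      have "Y \<inter> half_edges_at G v = {h \<in> half_edges_at G v. h \<in> Y}" by blast
      moreover have "int (card {h \<in> half_edges_at G v. h \<in> Y}) = (\<Sum>h\<in>half_edges_at G v. of_bool (h \<in> Y))"
        by (simp only: of_bool_def card_eq_sum sum.inter_filter[OF fin(4)] of_nat_sum)
          (rule sum.cong, simp_all)
      ultimately show ?thesis by simp
    qed
    finally show ?thesis by (simp add: card_Y[OF v] demand_sum[OF v, symmetric] del: of_nat_sum)
  qed
  moreover have "g e = 1 \<or> g e = -2" for e by (simp add: g_def)
  ultimately show ?thesis by blast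
qed

end

section \<open>Bridges and the doubling of edges\<close>

lemma sym_adjacency: "sym (adjacency G)"
proof (rule symI)
  fix x y assume "(x, y) \<in> adjacency G"
  then obtain h where h: "h \<in> half_edges G" "x = ends G h" "y = ends G (opp h)"
    by (auto simp: adjacency_def)
  hence "opp h \<in> half_edges G" "opp (opp h) = h" by (auto simp: half_edges_def opp_def)
  thus "(y, x) \<in> adjacency G" using h unfolding adjacency_def
    by (intro CollectI exI[of _ "opp h"]) simp
qed

text \<open>
  Every component of \<open>G\<close> is the closure of a component of the graph without \<open>e\<close>, and the two ends of \<open>e\<close>
  lie in distinct components of the latter with the same closure.
\<close>
lemma one_edge_cut_bridge:
  assumes sg: "signed_graph G" and cut: "one_edge_cut G S e"
  shows "e \<in> bridges G"
proof -
  let ?R = "(adjacency G)\<^sup>*" and ?R' = "(adjacency (delete_edge G e))\<^sup>*"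
  let ?u = "ends G (e, False)" and ?w = "ends G (e, True)"
  have e: "e \<in> edges G" "(?u \<in> S) \<noteq> (?w \<in> S)"
    and other: "\<And>e'. e' \<in> edges G \<Longrightarrow> e' \<noteq> e \<Longrightarrow> (ends G (e', False) \<in> S) = (ends G (e', True) \<in> S)"
    using cut unfolding one_edge_cut_def by blast+
  have "adjacency (delete_edge G e) \<subseteq> adjacency G"
    by (auto simp: adjacency_def delete_edge_def half_edges_def)
  hence sub: "?R' \<subseteq> ?R" by (rule rtrancl_mono)
  have symR: "sym ?R" by (rule sym_rtrancl[OF sym_adjacency])
  have image: "?R `` (?R' `` {x}) = ?R `` {x}" for x
    using sub by (auto intro: rtrancl_trans)
  have "components G = (\<lambda>C. ?R `` C) ` components (delete_edge G e)"
  proof -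
    have "components (delete_edge G e) = (\<lambda>x. ?R' `` {x}) ` verts G"
      by (auto simp: components_def quotient_def delete_edge_def)
    moreover have "components G = (\<lambda>x. ?R `` {x}) ` verts G"
      by (auto simp: components_def quotient_def)
    ultimately show ?thesis by (simp only: image_image image)
  qed
  moreover have fin: "finite (components (delete_edge G e))"
    using sg by (auto simp: components_def signed_graph_def delete_edge_def quotient_def)
  moreover have "\<not> inj_on (\<lambda>C. ?R `` C) (components (delete_edge G e))"
  proof
    assume inj: "inj_on (\<lambda>C. ?R `` C) (components (delete_edge G e))"
    have verts: "?u \<in> verts G" "?w \<in> verts G"
      using sg e(1) by (auto simp: signed_graph_def half_edges_def)
    have "(?u, ?w) \<in> adjacency G" using e(1) unfolding adjacency_def half_edges_def opp_def
      by (intro CollectI exI[of _ "(e, False)"]) simp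
    hence uw: "(?u, ?w) \<in> ?R" by blast
    hence wu: "(?w, ?u) \<in> ?R" using symR by (auto dest: symD)
    have "?R `` {?u} = ?R `` {?w}" using uw wu by (auto intro: rtrancl_trans)
    hence "?R `` (?R' `` {?u}) = ?R `` (?R' `` {?w})" by (simp only: image)
    moreover have "?R' `` {?u} \<in> components (delete_edge G e)" "?R' `` {?w} \<in> components (delete_edge G e)"
      using verts by (auto simp: components_def delete_edge_def intro!: quotientI)
    ultimately have "?R' `` {?u} = ?R' `` {?w}" using inj by (auto dest: inj_onD)
    hence reach: "(?u, ?w) \<in> ?R'" by blast
    have step: "(x \<in> S) = (y \<in> S)" if xy: "(x, y) \<in> adjacency (delete_edge G e)" for x y
    proof -
      obtain e' b where "e' \<in> edges G" "e' \<noteq> e" "x = ends G (e', b)" "y = ends G (e', \<not> b)"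
        using xy by (auto simp: adjacency_def delete_edge_def half_edges_def opp_def)
      thus ?thesis using other[of e'] by (cases b) auto
    qed
    have "(?u \<in> S) = (y \<in> S)" if "(?u, y) \<in> ?R'" for y
      using that by (induction rule: rtrancl_induct) (use step in auto)
    thus False using reach e(2) by blast
  qed
  ultimately have "card (components G) < card (components (delete_edge G e))"
    by (metis card_image_le eq_card_imp_inj_on le_neq_implies_less)
  thus ?thesis using e(1) by (simp add: bridges_def)
qed

text \<open>
  The Boolean in the new edge type is \<open>False\<close> for the original edges and \<open>True\<close> for the parallel copies
  of those in \<open>B\<close>.
\<close>
definition double_edges :: "'e set \<Rightarrow> ('v, 'e) sgraph \<Rightarrow> ('v, 'e \<times> bool) sgraph" where
  "double_edges B G = \<lparr>verts = verts G, edges = {(e, i). e \<in> edges G \<and> (i \<longrightarrow> e \<in> B)},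
     ends = (\<lambda>h. ends G (fst (fst h), snd h)), signature = (\<lambda>x. signature G (fst x))\<rparr>"

lemma sum_half_edges_at_double:
  assumes "finite (edges G)"
  shows "sum F (half_edges_at (double_edges B G) v) =
    (\<Sum>(e, b)\<in>half_edges_at G v. F ((e, False), b) + (if e \<in> B then F ((e, True), b) else 0))"
proof -
  let ?H = "half_edges_at G v"
  have finH: "finite ?H" using assms by (simp add: half_edges_at_def half_edges_def)
  let ?i = "\<lambda>i h. ((fst h, i), snd h) :: ('a \<times> bool) \<times> bool"
  have split: "half_edges_at (double_edges B G) v = ?i False ` ?H \<union> ?i True ` {h \<in> ?H. fst h \<in> B}"
  proof (rule set_eqI)
    fix x :: "('a \<times> bool) \<times> bool"
    obtain e i b where x: "x = ((e, i), b)" by (cases x) auto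
    show "x \<in> half_edges_at (double_edges B G) v \<longleftrightarrow> x \<in> ?i False ` ?H \<union> ?i True ` {h \<in> ?H. fst h \<in> B}"
      unfolding x by (cases i) (force simp: half_edges_at_def half_edges_def double_edges_def image_iff)+
  qed
  have inj: "inj_on (?i c) A" for c A by (auto simp: inj_on_def prod_eq_iff)
  have "sum F (half_edges_at (double_edges B G) v) =
      sum F (?i False ` ?H) + sum F (?i True ` {h \<in> ?H. fst h \<in> B})"
    unfolding split using finH by (intro sum.union_disjoint) auto
  also have "\<dots> = (\<Sum>h\<in>?H. F (?i False h)) + (\<Sum>h\<in>{h \<in> ?H. fst h \<in> B}. F (?i True h))"
    by (simp only: sum.reindex[OF inj] comp_def)
  also have "(\<Sum>h\<in>{h \<in> ?H. fst h \<in> B}. F (?i True h)) = (\<Sum>h\<in>?H. if fst h \<in> B then F (?i True h) else 0)"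
    by (rule sum.inter_filter[OF finH])
  finally show ?thesis by (simp add: sum.distrib case_prod_beta)
qed

lemma of_int_3_eq_0: "of_int z = (0 :: 3) \<Longrightarrow> 3 dvd z"
  by (simp add: bit1.of_int_eq zero_bit1_def Abs_bit1_inject mod_eq_0_iff_dvd)

lemma Z3_cases: "(x :: 3) = 0 \<or> x = 1 \<or> x = -1"
proof (cases x)
  case (of_int z)
  hence "z = 0 \<or> z = 1 \<or> z = 2" by auto
  moreover have "(2 :: 3) = -1" by simp
  ultimately show ?thesis using of_int by auto
qed

lemma sign_times_int: "s = 1 \<or> s = -1 \<Longrightarrow> sign_times s a = s * (a :: int)"
  by (auto simp: sign_times_def)

theorem theorem3p2:
  fixes G :: "('v, 'e) sgraph"
  assumes "signed_graph G"
    and "\<exists>\<tau> (f :: 'e \<Rightarrow> 3). orientation G \<tau> \<and> flow G \<tau> f \<and> nowhere_zero G f"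
  shows "\<exists>\<tau> (g :: 'e \<Rightarrow> int). orientation G \<tau> \<and> k_flow 5 G \<tau> g \<and> nowhere_zero G g
    \<and> edges_with_abs G g 3 = {} \<and> edges_with_abs G g 4 \<subseteq> bridges G"
proof -
  obtain \<tau> and f :: "'e \<Rightarrow> 3" where orient: "orientation G \<tau>"
    and flow: "flow G \<tau> f" and nz: "nowhere_zero G f"
    using assms(2) by blast
  note sg = assms(1)
  \<comment> \<open>The representative of \<open>f\<close> in \<open>{1, -1}\<close>.\<close>
  define s where "s e = (if f e = 1 then 1 else -1 :: int)" for e
  have tau: "\<tau> h = 1 \<or> \<tau> h = -1" if "h \<in> half_edges G" for h
    using orient that by (auto simp: orientation_def)
  have fs: "f e = of_int (s e)" if "e \<in> edges G" for e
    using nz that Z3_cases[of "f e"] by (auto simp: s_def nowhere_zero_def)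
  have lifted: "3 dvd (\<Sum>h\<in>half_edges_at G v. \<tau> h * s (fst h))" if v: "v \<in> verts G" for v
  proof (rule of_int_3_eq_0)
    have "of_int (\<Sum>h\<in>half_edges_at G v. \<tau> h * s (fst h)) = boundary G \<tau> f v"
      unfolding boundary_def of_int_sum
    proof (rule sum.cong[OF refl])
      fix h assume "h \<in> half_edges_at G v"
      hence h: "h \<in> half_edges G" "fst h \<in> edges G" by (auto simp: half_edges_at_def half_edges_def)
      show "of_int (\<tau> h * s (fst h)) = sign_times (\<tau> h) (f (fst h))"
        using tau[OF h(1)] fs[OF h(2)] by (auto simp: sign_times_def)
    qed
    thus "of_int (\<Sum>h\<in>half_edges_at G v. \<tau> h * s (fst h)) = (0 :: 3)"
      using flow v by (simp add: flow_def)
  qed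
  let ?B = "bridges G"
  let ?D = "double_edges ?B G"
  \<comment> \<open>Reorienting by \<open>r\<close> turns the value \<open>s e\<close>, or \<open>-s e\<close> on the copies of a bridge, into the constant \<open>1\<close>.\<close>
  define r where "r e = (if e \<in> ?B then - s e else s e)" for e
  have r: "r e = 1 \<or> r e = -1" for e by (simp add: r_def s_def)
  define \<tau>' where "\<tau>' x = \<tau> (fst (fst x), snd x) * r (fst (fst x))" for x :: "('e \<times> bool) \<times> bool"
  interpret D: mod3_orientation ?D \<tau>'
  proof
    have "edges ?D \<subseteq> edges G \<times> UNIV" by (auto simp: double_edges_def)
    hence "finite (edges ?D)" using sg by (rule_tac finite_subset) (auto simp: signed_graph_def)
    thus "signed_graph ?D" using sg
      by (auto simp: signed_graph_def double_edges_def half_edges_def)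
    show "orientation ?D \<tau>'"
      unfolding orientation_def
    proof (intro ballI conjI)
      fix x assume "x \<in> half_edges ?D"
      then obtain e i b where x: "x = ((e, i), b)" and e: "(e, b) \<in> half_edges G"
        by (cases x) (auto simp: half_edges_def double_edges_def)
      show "\<tau>' x \<in> {-1, 1}" using tau[OF e] r[of e] by (auto simp: \<tau>'_def x)
      have "\<tau> (e, b) * \<tau> (e, \<not> b) = - signature G e" using orient e by (auto simp: orientation_def opp_def)
      thus "\<tau>' x * \<tau>' (opp x) = - signature ?D (fst x)"
        using r[of e] by (auto simp: \<tau>'_def x opp_def double_edges_def)
    qed
    show "\<not> one_edge_cut ?D S x" for S x
    proof
      assume cut: "one_edge_cut ?D S x"
      let ?X = "\<lambda>e. (ends G (e, False) \<in> S) \<noteq> (ends G (e, True) \<in> S)"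
      have eq: "(e \<in> edges G \<and> (i \<longrightarrow> e \<in> ?B) \<and> ?X e) = ((e, i) = x)" for e i
        using cut[unfolded one_edge_cut_def set_eq_iff, rule_format, of "(e, i)"]
        by (simp add: double_edges_def)
      obtain e i where x: "x = (e, i)" by (cases x)
      have e: "e \<in> edges G" "?X e" using eq[of e i] x by simp_all
      have "{e' \<in> edges G. ?X e'} = {e}"
      proof (rule set_eqI)
        fix e'
        have "e' = e" if "e' \<in> edges G" "?X e'" using that eq[of e' False] x by simp
        thus "e' \<in> {e' \<in> edges G. ?X e'} \<longleftrightarrow> e' \<in> {e}" using e by blast
      qed
      hence "e \<in> ?B" using one_edge_cut_bridge[OF sg] by (simp add: one_edge_cut_def)
      hence "(e, False) = x" "(e, True) = x" using eq[of e False] eq[of e True] e by simp_all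
      hence "(e, False) = (e, True)" by (simp only:)
      thus False by simp
    qed
    fix v assume "v \<in> verts ?D"
    hence v: "v \<in> verts G" by (simp add: double_edges_def)
    have "(\<Sum>x\<in>half_edges_at ?D v. \<tau>' x) =
        (\<Sum>h\<in>half_edges_at G v. \<tau> h * s (fst h) - 3 * (if fst h \<in> ?B then \<tau> h * s (fst h) else 0))"
      using sg by (subst sum_half_edges_at_double)
        (auto simp: signed_graph_def \<tau>'_def r_def intro!: sum.cong)
    also have "\<dots> = (\<Sum>h\<in>half_edges_at G v. \<tau> h * s (fst h))
        - 3 * (\<Sum>h\<in>half_edges_at G v. if fst h \<in> ?B then \<tau> h * s (fst h) else 0)"
      by (simp only: sum_subtractf sum_distrib_left)
    also have "3 dvd \<dots>" using lifted[OF v] by simp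
    finally show "3 dvd (\<Sum>x\<in>half_edges_at ?D v. \<tau>' x)" .
  qed
  obtain g' where g': "\<forall>x. g' x = 1 \<or> g' x = -2"
    and zero: "\<forall>v\<in>verts ?D. (\<Sum>x\<in>half_edges_at ?D v. \<tau>' x * g' (fst x)) = 0"
    using D.mod3_flow_lift by blast
  define g where "g e = r e * (g' (e, False) + (if e \<in> ?B then g' (e, True) else 0))" for e
  have abs: "\<bar>g e\<bar> = 1 \<or> \<bar>g e\<bar> = 2 \<or> e \<in> ?B \<and> \<bar>g e\<bar> = 4" for e
    using r[of e] g'[rule_format, of "(e, False)"] g'[rule_format, of "(e, True)"]
    by (auto simp: g_def abs_mult)
  have "flow G \<tau> g"
    unfolding flow_def
  proof
    fix v assume v: "v \<in> verts G"
    have "boundary G \<tau> g v = (\<Sum>h\<in>half_edges_at G v. \<tau> h * g (fst h))"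
      unfolding boundary_def by (intro sum.cong sign_times_int tau refl) (auto simp: half_edges_at_def)
    also have "\<dots> = (\<Sum>x\<in>half_edges_at ?D v. \<tau>' x * g' (fst x))"
      using sg by (subst sum_half_edges_at_double)
        (auto simp: signed_graph_def \<tau>'_def g_def algebra_simps intro!: sum.cong)
    also have "\<dots> = 0" using zero v by (simp add: double_edges_def)
    finally show "boundary G \<tau> g v = 0" .
  qed
  moreover have "\<bar>g e\<bar> < 5" "g e \<noteq> 0" "\<bar>g e\<bar> \<noteq> 3" "\<bar>g e\<bar> = 4 \<Longrightarrow> e \<in> ?B" for e
    using abs[of e] by auto
  ultimately have "k_flow 5 G \<tau> g" "nowhere_zero G g" "edges_with_abs G g 3 = {}"
    "edges_with_abs G g 4 \<subseteq> bridges G"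
    by (auto simp: k_flow_def nowhere_zero_def edges_with_abs_def)
  thus ?thesis using orient by blast
qed

end
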